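(* Assume: (i) $(\mathbb{X},d)$ is a compact metric space with diameter $D=\sup_{x,y\in\mathbb{X}}d(x,y)$; (ii) $\mathcal{T}(\cdot\mid x,u)$ is continuous in total variation in $(x,u)$, i.e. $(x_n,u_n)\to(x,u)$ implies $\mathcal{T}(\cdot\mid x_n,u_n)\to\mathcal{T}(\cdot\mid x,u)$ in total variation; (iii) there is $\alpha\in\mathbb{R}^+$ with $\|\mathcal{T}(\cdot\mid x,u)-\mathcal{T}(\cdot\mid x',u)\|_{TV}\le\alpha\,d(x,x')$ for all $x,x'\in\mathbb{X}$, $u\in\mathbb{U}$; (iv) there is $K_1\in\mathbb{R}^+$ with $|c(x,u)-c(x',u)|\le K_1d(x,x')$ for all $x,x'\in\mathbb{X}$, $u\in\mathbb{U}$; (v) $c$ is continuous and bounded. Let $z_0^-,z^*\in\mathcal{P}(\mathbb{X})$ and, for integers $t\ge0$, $N\ge0$, $$\bar L_t^N:=\sup_{\hat\gamma\in\hat\Gamma}E_{z_0^-}^{\hat\gamma}\Big[W_1\Big(P^{z_t^-}(X_{t+N}\in\cdot\mid Y_{[t,t+N]},U_{[t,t+N-1]}),\,P^{z^*}(X_{t+N}\in\cdot\mid Y_{[t,t+N]},U_{[t,t+N-1]})\Big)\Big].$$ Then for all $t\ge0$ and $N\ge1$, $$\bar L_t^N\le\alpha\,\frac D2\,(2-\delta(Q))\,\bar L_t^{N-1}.$$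
   Context: $\mathbb{X}$ is the hidden state space; $\mathbb{Y}$ (observations) and $\mathbb{U}$ (actions) are finite sets; $\mathcal{P}(\mathbb{X})$ is the set of Borel probability measures on $\mathbb{X}$. $\mathcal{T}$ is a stochastic kernel from $\mathbb{X}\times\mathbb{U}$ to $\mathbb{X}$, $Q$ a stochastic kernel from $\mathbb{X}$ to $\mathbb{Y}$, and $c:\mathbb{X}\times\mathbb{U}\to\mathbb{R}$ a stage cost. Dynamics: $X_0\sim z_0^-$; given the past, $X_{t+1}\sim\mathcal{T}(\cdot\mid X_t,U_t)$ and $Y_t\sim Q(\cdot\mid X_t)$. An admissible policy chooses $U_t$ as a measurable function of $(Y_{[0,t]},U_{[0,t-1]})$; $E^{\gamma}_{z_0^-}$ is the expectation under policy $\gamma$. Notation: $Y_{[s,t]}=(Y_s,\dots,Y_t)$, similarly for $U$ (empty if $s>t$). For a prior $z$ on the state at time $t$, $P^z(X_{t+k}\in\cdot\mid y_{[t,t+k]},u_{[t,t+k-1]})=:\pi_k$ is the Bayes posterior: $\pi_0(dx)\propto Q(y_t\mid x)z(dx)$ and $\pi_{k+1}(dx)\propto Q(y_{t+k+1}\mid x)\int\mathcal{T}(dx\mid x',u_{t+k})\pi_k(dx')$ (if a normalizing constant is $0$, a fixed arbitrary probability measure is used). The true predictor is $z_t^-(\cdot)=P^{z_0^-}(X_t\in\cdot\mid Y_{[0,t-1]},U_{[0,t-1]})$ for $t\ge1$ (with $z_0^-$ the given prior). In the definition of $\bar L_t^N$, $\hat\Gamma$ is the set of Markov control policies for the controlled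 window state $\hat z_n=(z_{n-N}^-,Y_{[n-N,n]},U_{[n-N,n-1]})$, $n\ge N$, i.e. policies mapping $(\hat z_n,n)$ to $U_n$; on the first $N$ steps actions are functions of the information $(Y_{[0,n]},U_{[0,n-1]})$ available so far. $\|\mu-\nu\|_{TV}=2\sup_B|\mu(B)-\nu(B)|$, supremum over Borel sets. $W_1(\mu,\nu)=\sup\{\int f\,d\mu-\int f\,d\nu:\ f:\mathbb{X}\to\mathbb{R},\ |f(x)-f(x')|\le d(x,x')\ \forall x,x'\}$. The Dobrushin coefficient of a stochastic kernel $K$ from $S_1$ to $S_2$ is $\delta(K)=\inf\sum_{i=1}^n\min(K(x,A_i),K(y,A_i))$, the infimum over all $x,y\in S_1$ and all finite measurable partitions $\{A_i\}_{i=1}^n$ of $S_2$. *)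

theory Defs
  imports "HOL-Probability.Probability"
begin

text \<open>Total variation distance with the factor-two convention (values in \<open>[0,2]\<close>).\<close>

definition tv_dist :: "'x::topological_space measure \<Rightarrow> 'x measure \<Rightarrow> real" where
  "tv_dist \<mu> \<nu> = 2 * (SUP B\<in>sets borel. \<bar>measure \<mu> B - measure \<nu> B\<bar>)"

definition W1 :: "'x::metric_space measure \<Rightarrow> 'x measure \<Rightarrow> real" where
  "W1 \<mu> \<nu> = (SUP f\<in>{f :: 'x \<Rightarrow> real. \<forall>x x'. \<bar>f x - f x'\<bar> \<le> dist x x'}.
               integral\<^sup>L \<mu> f - integral\<^sup>L \<nu> f)"

text \<open>A stochastic kernel from \<open>S1\<close> to \<open>S2\<close> is an element of
  \<open>S1 \<rightarrow>\<^sub>M prob_algebra S2\<close>.  In this convention the coefficient is 1 for a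
  constant kernel.\<close>

definition dobrushin :: "'a measure \<Rightarrow> 'b measure \<Rightarrow> ('a \<Rightarrow> 'b measure) \<Rightarrow> real" where
  "dobrushin S1 S2 K =
     Inf {\<Sum>A\<in>P. min (measure (K x) A) (measure (K y) A) | x y P.
            x \<in> space S1 \<and> y \<in> space S1 \<and>
            finite P \<and> P \<subseteq> sets S2 \<and> partition_on (space S2) P}"

text \<open>A policy chooses \<open>U\<^sub>n\<close> from the lists \<open>Y\<^sub>0, \<dots>, Y\<^sub>n\<close> and \<open>U\<^sub>0, \<dots>, U\<^sub>n\<^sub>-\<^sub>1\<close>;
  the time \<open>n\<close> is the length of the second list.  Observations and actions range over
  finite types, so such a map is automatically measurable.\<close>

type_synonym ('y, 'u) policy = "'y list \<Rightarrow> 'u list \<Rightarrow> 'u"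

context
  fixes T :: "'x::metric_space \<times> 'u::finite \<Rightarrow> 'x measure"
    and Q :: "'x \<Rightarrow> 'y::finite measure"
begin

abbreviation hist_algebra :: "('x \<times> 'y list \<times> 'u list) measure" where
  "hist_algebra \<equiv> borel \<Otimes>\<^sub>M (count_space UNIV \<Otimes>\<^sub>M count_space UNIV)"

text \<open>\<open>joint_law z \<gamma> n\<close> is the law of \<open>(X\<^sub>n, [Y\<^sub>0, \<dots>, Y\<^sub>n], [U\<^sub>0, \<dots>, U\<^sub>n\<^sub>-\<^sub>1])\<close> under
  the policy \<open>\<gamma>\<close> when \<open>X\<^sub>0\<close> has law \<open>z\<close>.\<close>

primrec joint_law ::
  "'x measure \<Rightarrow> ('y, 'u) policy \<Rightarrow> nat \<Rightarrow> ('x \<times> 'y list \<times> 'u list) measure" where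
  "joint_law z \<gamma> 0 =
     z \<bind> (\<lambda>x. Q x \<bind> (\<lambda>y. return hist_algebra (x, [y], [])))"
| "joint_law z \<gamma> (Suc n) =
     joint_law z \<gamma> n \<bind> (\<lambda>(x, ys, us).
       T (x, \<gamma> ys us) \<bind> (\<lambda>x'.
         Q x' \<bind> (\<lambda>y'. return hist_algebra (x', ys @ [y'], us @ [\<gamma> ys us]))))"

text \<open>\<open>\<rho>\<close> is the fixed probability measure used when a normalizing constant vanishes.\<close>

context
  fixes \<rho> :: "'x measure"
begin

definition bayes_update :: "'x measure \<Rightarrow> 'y \<Rightarrow> 'x measure" where
  "bayes_update \<mu> y =
     (let m = (\<integral>x. measure (Q x) {y} \<partial>\<mu>)
      in if m = 0 then \<rho> else density \<mu> (\<lambda>x. ennreal (measure (Q x) {y} / m)))"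

text \<open>\<open>posterior z y u k\<close> is the posterior of \<open>X\<^sub>t\<^sub>+\<^sub>k\<close> for the prior \<open>z\<close> on \<open>X\<^sub>t\<close>, where
  \<open>y j\<close> and \<open>u j\<close> stand for \<open>y\<^sub>t\<^sub>+\<^sub>j\<close> and \<open>u\<^sub>t\<^sub>+\<^sub>j\<close>; only \<open>y 0, \<dots>, y k\<close> and
  \<open>u 0, \<dots>, u (k - 1)\<close> are used.\<close>

primrec posterior ::
  "'x measure \<Rightarrow> (nat \<Rightarrow> 'y) \<Rightarrow> (nat \<Rightarrow> 'u) \<Rightarrow> nat \<Rightarrow> 'x measure" where
  "posterior z y u 0 = bayes_update z (y 0)"
| "posterior z y u (Suc k) =
     bayes_update (posterior z y u k \<bind> (\<lambda>x. T (x, u k))) (y (Suc k))"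

text \<open>\<open>predictor z ys us\<close> is the conditional law of \<open>X\<^sub>t\<close> given the observations
  \<open>ys\<close> and actions \<open>us\<close> at times \<open>0, \<dots>, t - 1\<close>.  The conditional law does not depend on
  the policy under which \<open>us\<close> arose (a policy only contributes factors that are functions of
  \<open>(ys, us)\<close>), so the conditioning is done in the law where the actions \<open>us\<close> are simply
  played.  In \<open>joint_law\<close> at time \<open>t\<close> the last observation is \<open>Y\<^sub>t\<close>, which \<open>butlast\<close> drops.\<close>

definition predictor :: "'x measure \<Rightarrow> 'y list \<Rightarrow> 'u list \<Rightarrow> 'x measure" where
  "predictor z ys us =
     (if us = [] then z
      else let J = joint_law z (\<lambda>_ vs. us ! length vs) (length us);
               E = {(x, ys', us'). butlast ys' = ys \<and> us' = us}
           in if measure J E = 0 then \<rho> else distr (uniform_measure J E) borel fst)"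

text \<open>The window state \<open>(z\<^sub>n\<^sub>-\<^sub>N, Y\<^sub>n\<^sub>-\<^sub>N, \<dots>, Y\<^sub>n, U\<^sub>n\<^sub>-\<^sub>N, \<dots>, U\<^sub>n\<^sub>-\<^sub>1)\<close> for \<open>n = length us \<ge> N\<close>,
  with \<open>z\<^sub>n\<^sub>-\<^sub>N\<close> the predictor.\<close>

definition window ::
  "'x measure \<Rightarrow> nat \<Rightarrow> 'y list \<Rightarrow> 'u list \<Rightarrow> 'x measure \<times> 'y list \<times> 'u list" where
  "window z N ys us =
     (let s = length us - N
      in (predictor z (take s ys) (take s us), drop s ys, drop s us))"

definition window_policies :: "'x measure \<Rightarrow> nat \<Rightarrow> ('y, 'u) policy set" where
  "window_policies z N =
     {\<gamma>. \<exists>g :: nat \<Rightarrow> 'x measure \<times> 'y list \<times> 'u list \<Rightarrow> 'u.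
          (\<forall>n\<ge>N. g n \<in> prob_algebra borel \<Otimes>\<^sub>M (count_space UNIV \<Otimes>\<^sub>M count_space UNIV)
                        \<rightarrow>\<^sub>M count_space UNIV) \<and>
          (\<forall>ys us. N \<le> length us \<and> length ys = Suc (length us) \<longrightarrow>
             \<gamma> ys us = g (length us) (window z N ys us))}"

definition Lbar :: "'x measure \<Rightarrow> 'x measure \<Rightarrow> nat \<Rightarrow> nat \<Rightarrow> real" where
  "Lbar z0 zstar t N =
     (SUP \<gamma>\<in>window_policies z0 N.
        \<integral>(x, ys, us).
          W1 (posterior (predictor z0 (take t ys) (take t us))
                (\<lambda>j. ys ! (t + j)) (\<lambda>j. us ! (t + j)) N)
             (posterior zstar (\<lambda>j. ys ! (t + j)) (\<lambda>j. us ! (t + j)) N)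
        \<partial>joint_law z0 \<gamma> (t + N))"

end

end

end

theory Submission
  imports Defs
begin

text \<open>The inequality has two independent parts: a one-step contraction that holds along every
policy, and the fact that the two suprema, which range over different classes of policies, can be
compared.

Contraction. Fix the history up to time \<open>t + N - 1\<close>, let \<open>\<pi>\<close> and \<open>\<pi>'\<close> be the two posteriors (from
the true predictor and from \<open>zstar\<close>), \<open>u\<close> the action, and let \<open>\<mu>\<close>, \<open>\<nu>\<close> be \<open>\<pi>\<close>, \<open>\<pi>'\<close> pushed through
\<open>T (\<sqdot>, u)\<close>. The next observation is \<open>y\<close> with probability \<open>p y = (\<integral>x. Q(y | x) \<partial>\<mu>)\<close>, since \<open>\<pi>\<close> is the
true conditional law. Write \<open>\<mu>\<^sub>y\<close>, \<open>\<nu>\<^sub>y\<close> for the updated measures and choose for each \<open>y\<close> a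
1-Lipschitz test function \<open>f\<^sub>y\<close>, shifted to have values in \<open>[0, D]\<close> with \<open>D\<close> the diameter. With
\<open>k\<^sub>y = \<integral> f\<^sub>y \<partial>\<nu>\<^sub>y\<close>,
\<open>h\<^sub>1 = \<Sum>y. Q(y | \<sqdot>) f\<^sub>y\<close> and \<open>h\<^sub>2 = \<Sum>y. Q(y | \<sqdot>) k\<^sub>y\<close> one has \<open>\<integral> h\<^sub>1 \<partial>\<nu> = \<integral> h\<^sub>2 \<partial>\<nu>\<close> and therefore
\<open>\<Sum>y. p y (\<integral> f\<^sub>y \<partial>\<mu>\<^sub>y - \<integral> f\<^sub>y \<partial>\<nu>\<^sub>y) = (\<integral> h\<^sub>1 \<partial>\<mu> - \<integral> h\<^sub>1 \<partial>\<nu>) + (\<integral> h\<^sub>2 \<partial>\<nu> - \<integral> h\<^sub>2 \<partial>\<mu>)\<close>.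
The function \<open>h\<^sub>1\<close> oscillates by at most \<open>D\<close> and \<open>h\<^sub>2\<close> by at most \<open>D (1 - \<delta>)\<close>, because it averages
the numbers \<open>k\<^sub>y \<in> [0, D]\<close> over the channel. Finally a function of oscillation \<open>L\<close> becomes, after
integration against \<open>T (\<sqdot>, u)\<close>, a function with Lipschitz constant \<open>L \<alpha> / 2\<close>, so its integrals
against \<open>\<pi>\<close> and \<open>\<pi>'\<close> differ by at most \<open>(L \<alpha> / 2) W1 \<pi> \<pi>'\<close>. The two terms add up to
\<open>\<alpha> (D / 2) (2 - \<delta>) W1 \<pi> \<pi>'\<close>. This is \<open>one_step\<close>; \<open>weighted_dist_step\<close> is its form for histories.

Comparison of policies. The left side ranges over policies that see a window of length \<open>N\<close>, the
right side over policies that see one of length \<open>N - 1\<close>, and a policy of the first kind need not be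
of the second kind. The right side is however the supremum over all history-dependent policies
(\<open>policy_total_le_Lbar\<close>): observations, actions and horizon are finite, so backward induction
produces a greedy policy that is optimal, and with \<open>M = N - 1\<close> the value of an action at time \<open>n\<close>
with \<open>M \<le> n < t + M\<close> is a nonnegative multiple, depending on the history only, of a
function of the window state, because the predictor at time \<open>t\<close> can be computed from the predictor
at time \<open>n - M \<le> t\<close> and the observations and actions since then. Hence the greedy action can be
chosen as a function of the window state (\<open>greedy_window_policy\<close>).

To avoid divisions by normalizing constants, both parts are carried out with the unnormalized
filter \<open>unfilt\<close>, whose total mass is the probability of the observations when the given actions are
played. Expectations under a policy are then finite sums over observation words
(\<open>nn_integral_joint_law\<close>), and posterior and predictor are the normalizations of \<open>unfilt\<close> and
\<open>unpred\<close> (\<open>unfilt_eq_posterior\<close>, \<open>unpred_eq_predictor\<close>).\<close>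

section \<open>Scaling of measures and sums over words\<close>

lemma bind_scale_measure:
  assumes K: "K \<in> M \<rightarrow>\<^sub>M subprob_algebra N" and ne: "space M \<noteq> {}"
  shows "scale_measure r M \<bind> K = scale_measure r (M \<bind> K)"
proof (rule measure_eqI)
  have ne': "space (scale_measure r M) \<noteq> {}" using ne by (simp add: space_scale_measure)
  have K': "K \<in> scale_measure r M \<rightarrow>\<^sub>M subprob_algebra N" using K by (simp cong: measurable_cong_sets)
  have s: "\<And>x. x \<in> space M \<Longrightarrow> sets (K x) = sets N" 
    using K by (meson sets_kernel)
  show eq: "sets (scale_measure r M \<bind> K) = sets (scale_measure r (M \<bind> K))"
    using sets_bind[of "scale_measure r M" K N] sets_bind[of M K N] s ne ne' by (simp add: space_scale_measure)
  fix X assume "X \<in> sets (scale_measure r M \<bind> K)"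
  then have X: "X \<in> sets N" using sets_bind[of M K N] s ne by (simp add: eq)
  show "emeasure (scale_measure r M \<bind> K) X = emeasure (scale_measure r (M \<bind> K)) X"
    using emeasure_bind[OF ne' K' X] emeasure_bind[OF ne K X] 
    measurable_emeasure_kernel[OF K X]
    by (simp add: nn_integral_scale_measure)
qed

lemma density_scale_measure:
  assumes f: "f \<in> borel_measurable M"
  shows "density (scale_measure r M) f = scale_measure r (density M f)"
proof (rule measure_eqI)
  fix X assume "X \<in> sets (density (scale_measure r M) f)"
  then have X[measurable]: "X \<in> sets M" by simp
  note f[measurable]
  have f'[measurable]: "f \<in> borel_measurable (scale_measure r M)" by measurable
  show "emeasure (density (scale_measure r M) f) X = emeasure (scale_measure r (density M f)) X"
    by (simp add: emeasure_density nn_integral_scale_measure f' X f)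
qed simp

lemma measurable_discrete2:
  fixes h :: "'a::countable \<Rightarrow> 'b::countable \<Rightarrow> 'c"
  assumes "f \<in> M \<rightarrow>\<^sub>M count_space UNIV" "g \<in> M \<rightarrow>\<^sub>M count_space UNIV"
  shows "(\<lambda>x. h (f x) (g x)) \<in> M \<rightarrow>\<^sub>M count_space UNIV"
proof -
  have "(\<lambda>x. (f x, g x)) \<in> M \<rightarrow>\<^sub>M count_space (UNIV \<times> UNIV)"
    using assms by (simp flip: pair_measure_countable)
  from measurable_compose[OF this, of "case_prod h" "count_space UNIV"] show ?thesis by simp
qed

lemma sum_lists_snoc:
  fixes f :: "'y::finite list \<Rightarrow> 'b::comm_monoid_add"
  shows "(\<Sum>ys | length ys = Suc n. f ys) = (\<Sum>ys | length ys = n. \<Sum>y\<in>UNIV. f (ys @ [y]))"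
proof -
  have "(\<Sum>ys | length ys = n. \<Sum>y\<in>UNIV. f (ys @ [y])) = (\<Sum>(ys, y)\<in>{ys. length ys = n} \<times> UNIV. f (ys @ [y]))"
    using finite_lists_length_eq[of "UNIV :: 'y set" n] by (subst sum.cartesian_product) auto
  also have "\<dots> = (\<Sum>ys | length ys = Suc n. f ys)"
  proof (rule sum.reindex_bij_witness[of _ "\<lambda>ys. (butlast ys, last ys)" "\<lambda>(ys, y). ys @ [y]"])
    fix b :: "'y list" assume "b \<in> {ys. length ys = Suc n}"
    then have "b \<noteq> []" by auto
    then show "(case (butlast b, last b) of (ys, y) \<Rightarrow> ys @ [y]) = b" by simp
  qed auto
  finally show ?thesis ..
qed

lemma prob_space_if_prob_algebra: "M \<in> space (prob_algebra N) \<Longrightarrow> prob_space M"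
  and sets_if_prob_algebra: "M \<in> space (prob_algebra N) \<Longrightarrow> sets M = sets N"
  unfolding space_prob_algebra by simp_all

lemma scale_measure_cancel:
  assumes "scale_measure a M = scale_measure a N" "a \<noteq> 0" "a \<noteq> top"
  shows "M = N"
proof (rule measure_eqI)
  show "sets M = sets N" using arg_cong[OF assms(1), of sets] by simp
  fix A
  have "a * emeasure M A = a * emeasure N A"
    using arg_cong[OF assms(1), of "\<lambda>M. emeasure M A"] by simp
  then show "emeasure M A = emeasure N A" using assms(2,3) by (simp add: ennreal_mult_cancel_left)
qed

section \<open>Unnormalized filtering recursion\<close>

text \<open>The measurability assumptions on the model alone; the fallback measure \<open>\<rho>\<close> is included because the
Bayes update refers to it.\<close>

locale pomdp =
  fixes T :: "'x::metric_space \<times> 'u::finite \<Rightarrow> 'x measure"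
    and Q :: "'x \<Rightarrow> 'y::finite measure"
    and \<rho> :: "'x measure"
  assumes T_prob [measurable]: "T \<in> borel \<Otimes>\<^sub>M count_space UNIV \<rightarrow>\<^sub>M prob_algebra borel"
    and Q_prob [measurable]: "Q \<in> borel \<rightarrow>\<^sub>M prob_algebra (count_space UNIV)"
    and \<rho>_prob: "\<rho> \<in> space (prob_algebra borel)"
begin

abbreviation lik :: "'y \<Rightarrow> 'x \<Rightarrow> real" where "lik y x \<equiv> measure (Q x) {y}"

lemma T_subprob [measurable]: "T \<in> borel \<Otimes>\<^sub>M count_space UNIV \<rightarrow>\<^sub>M subprob_algebra borel"
  using T_prob by (rule measurable_prob_algebraD)

lemma Q_subprob [measurable]: "Q \<in> borel \<rightarrow>\<^sub>M subprob_algebra (count_space UNIV)"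
  using Q_prob by (rule measurable_prob_algebraD)

lemma T_action_prob [measurable]: "(\<lambda>x. T (x, u)) \<in> borel \<rightarrow>\<^sub>M prob_algebra borel"
  by measurable

lemma T_action_subprob [measurable]: "(\<lambda>x. T (x, u)) \<in> borel \<rightarrow>\<^sub>M subprob_algebra borel"
  by measurable

lemma prob_space_T: "prob_space (T (x, u))" and sets_T [simp]: "sets (T (x, u)) = sets borel"
  using measurable_space[OF T_action_prob, of x u] by (auto simp: space_prob_algebra)

lemma prob_space_Q: "prob_space (Q x)" and sets_Q [simp]: "sets (Q x) = UNIV"
  using measurable_space[OF Q_prob, of x] by (auto simp: space_prob_algebra)

lemma lik_measurable [measurable]: "lik y \<in> borel_measurable borel"
  by measurable

lemma lik_le_1: "lik y x \<le> 1"
  using prob_space.prob_le_1[OF prob_space_Q] .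

lemma space_Q [simp]: "space (Q x) = UNIV"
  using sets_eq_imp_space_eq[of "Q x" "count_space UNIV"] by simp

lemma sum_lik: "(\<Sum>y\<in>A. lik y x) = measure (Q x) A"
proof -
  interpret prob_space "Q x" by (rule prob_space_Q)
  show ?thesis using finite_measure_eq_sum_singleton[of A] by simp
qed

lemma sum_lik_UNIV: "(\<Sum>y\<in>UNIV. lik y x) = 1"
  using prob_space.prob_space[OF prob_space_Q, of x] by (simp add: sum_lik)

lemma nn_integral_Q: "(\<integral>\<^sup>+y. f y \<partial>Q x) = (\<Sum>y\<in>UNIV. ennreal (lik y x) * f y)"
proof -
  interpret prob_space "Q x" by (rule prob_space_Q)
  have "Q x = density (count_space UNIV) (\<lambda>y. emeasure (Q x) {y})"
    by (rule measure_eqI_finite[of _ UNIV]) (auto simp: emeasure_density nn_integral_count_space_finite indicator_def if_distrib cong: if_cong)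
  then have "(\<integral>\<^sup>+y. f y \<partial>Q x) = (\<integral>\<^sup>+y. f y \<partial>density (count_space UNIV) (\<lambda>y. emeasure (Q x) {y}))"
    by simp
  then show ?thesis
    by (simp add: nn_integral_density nn_integral_count_space_finite emeasure_eq_measure)
qed

text \<open>The predictor and filter recursions with all normalizations left out. Being linear in the prior,
they satisfy a semigroup law and commute with scaling, and histories of probability \<open>0\<close> are
covered without a case distinction: they carry the zero measure.\<close>

primrec unpred :: "'x measure \<Rightarrow> (nat \<Rightarrow> 'y) \<Rightarrow> (nat \<Rightarrow> 'u) \<Rightarrow> nat \<Rightarrow> 'x measure" where
  "unpred z y u 0 = z"
| "unpred z y u (Suc n) = density (unpred z y u n) (lik (y n)) \<bind> (\<lambda>x. T (x, u n))"

definition unfilt :: "'x measure \<Rightarrow> (nat \<Rightarrow> 'y) \<Rightarrow> (nat \<Rightarrow> 'u) \<Rightarrow> nat \<Rightarrow> 'x measure" where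
  "unfilt z y u n = density (unpred z y u n) (lik (y n))"

lemma unpred_Suc: "unpred z y u (Suc n) = unfilt z y u n \<bind> (\<lambda>x. T (x, u n))"
  by (simp add: unfilt_def)

lemma sets_bind_T [simp]: "sets M = sets borel \<Longrightarrow> sets (M \<bind> (\<lambda>x. T (x, u))) = sets borel"
  using sets_eq_imp_space_eq[of M borel] by (subst sets_bind) auto

lemma sets_unpred [simp]: "sets z = sets borel \<Longrightarrow> sets (unpred z y u n) = sets borel"
  by (induction n) auto

lemma sets_unfilt [simp]: "sets z = sets borel \<Longrightarrow> sets (unfilt z y u n) = sets borel"
  by (simp add: unfilt_def)

lemma unpred_add: "unpred z y u (s + k) = unpred (unpred z y u s) (\<lambda>j. y (s + j)) (\<lambda>j. u (s + j)) k"
  by (induction k) auto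

lemma unfilt_add: "unfilt z y u (s + k) = unfilt (unpred z y u s) (\<lambda>j. y (s + j)) (\<lambda>j. u (s + j)) k"
  by (simp add: unfilt_def unpred_add)

lemma unpred_cong:
  "(\<And>j. j < n \<Longrightarrow> y j = y' j) \<Longrightarrow> (\<And>j. j < n \<Longrightarrow> u j = u' j) \<Longrightarrow> unpred z y u n = unpred z y' u' n"
  by (induction n) auto

lemma unfilt_cong:
  "(\<And>j. j \<le> n \<Longrightarrow> y j = y' j) \<Longrightarrow> (\<And>j. j < n \<Longrightarrow> u j = u' j) \<Longrightarrow> unfilt z y u n = unfilt z y' u' n"
  unfolding unfilt_def using unpred_cong[of n y y' u u' z] by simp

lemma posterior_cong:
  "(\<And>j. j \<le> k \<Longrightarrow> y j = y' j) \<Longrightarrow> (\<And>j. j < k \<Longrightarrow> u j = u' j) \<Longrightarrow>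
   posterior T Q \<rho> z y u k = posterior T Q \<rho> z y' u' k"
  by (induction k) auto

lemma density_lik_scale:
  "sets z = sets borel \<Longrightarrow> density (scale_measure r z) (lik y) = scale_measure r (density z (lik y))"
  by (rule density_scale_measure) (simp cong: measurable_cong_sets)

lemma bind_T_scale:
  assumes "sets z = sets borel"
  shows "scale_measure r z \<bind> (\<lambda>x. T (x, u)) = scale_measure r (z \<bind> (\<lambda>x. T (x, u)))"
  using assms sets_eq_imp_space_eq[of z borel]
  by (intro bind_scale_measure[where N = borel]) (auto cong: measurable_cong_sets)

lemma unpred_scale:
  "sets z = sets borel \<Longrightarrow> unpred (scale_measure r z) y u n = scale_measure r (unpred z y u n)"
  by (induction n) (auto simp: density_lik_scale bind_T_scale)

lemma unfilt_scale:
  "sets z = sets borel \<Longrightarrow> unfilt (scale_measure r z) y u n = scale_measure r (unfilt z y u n)"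
  by (simp add: unfilt_def unpred_scale density_lik_scale)

lemma emeasure_bind_T_UNIV:
  assumes "sets z = sets borel"
  shows "emeasure (z \<bind> (\<lambda>x. T (x, u))) UNIV = emeasure z UNIV"
proof -
  have [simp]: "space z = UNIV" using sets_eq_imp_space_eq[OF assms] by simp
  have "emeasure (T (x, u)) UNIV = 1" for x
    using prob_space.emeasure_space_1[OF prob_space_T, of x u] sets_eq_imp_space_eq[OF sets_T] by simp
  then show ?thesis
    by (subst emeasure_bind[where N = borel]) (auto simp: assms cong: measurable_cong_sets)
qed

text \<open>The likelihoods sum to \<open>1\<close>, so splitting a measure by the next observation loses no mass.\<close>

lemma density_lik_sum:
  assumes "sets z = sets borel" and B: "B \<in> sets borel"
  shows "(\<Sum>y\<in>UNIV. emeasure (density z (lik y)) B) = emeasure z B"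
proof -
  note assms(1)[measurable_cong] B[measurable]
  have "(\<Sum>y\<in>UNIV. emeasure (density z (lik y)) B) = (\<Sum>y\<in>UNIV. \<integral>\<^sup>+x. ennreal (lik y x) * indicator B x \<partial>z)"
    using assms by (subst emeasure_density) auto
  also have "\<dots> = (\<integral>\<^sup>+x. (\<Sum>y\<in>UNIV. ennreal (lik y x) * indicator B x) \<partial>z)"
    by (subst nn_integral_sum) auto
  also have "\<dots> = (\<integral>\<^sup>+x. indicator B x \<partial>z)"
    by (simp add: sum_lik_UNIV flip: sum_distrib_right)
  finally show ?thesis using assms by simp
qed

lemma emeasure_unfilt_le:
  assumes "sets z = sets borel"
  shows "emeasure (unfilt z y u n) UNIV \<le> emeasure z UNIV" "emeasure (unpred z y u n) UNIV \<le> emeasure z UNIV"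
proof -
  have *: "emeasure (density \<mu> (lik y)) UNIV \<le> emeasure \<mu> UNIV" if "sets \<mu> = sets borel" for \<mu> y
    unfolding density_lik_sum[OF that, of UNIV, symmetric, simplified]
    by (rule member_le_sum) auto
  show "emeasure (unpred z y u n) UNIV \<le> emeasure z UNIV"
  proof (induction n)
    case (Suc n)
    have "emeasure (unpred z y u (Suc n)) UNIV \<le> emeasure (unpred z y u n) UNIV"
      using *[of "unpred z y u n" "y n"] assms by (simp add: emeasure_bind_T_UNIV)
    with Suc show ?case by (meson order_trans)
  qed simp
  with * show "emeasure (unfilt z y u n) UNIV \<le> emeasure z UNIV"
    unfolding unfilt_def using assms by (meson order_trans sets_unpred)
qed

end

section \<open>Law of the observation history under a policy\<close>

text \<open>Policies are deterministic, hence the actions are determined by the observations: these are the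
first \<open>n\<close> actions played by \<open>\<gamma>\<close> when \<open>ys\<close> is observed.\<close>

primrec actions :: "('y, 'u) policy \<Rightarrow> 'y list \<Rightarrow> nat \<Rightarrow> 'u list" where
  "actions \<gamma> ys 0 = []"
| "actions \<gamma> ys (Suc n) = actions \<gamma> ys n @ [\<gamma> (take (Suc n) ys) (actions \<gamma> ys n)]"

lemma length_actions [simp]: "length (actions \<gamma> ys n) = n"
  by (induction n) auto

lemma actions_append [simp]: "n \<le> length ys \<Longrightarrow> actions \<gamma> (ys @ zs) n = actions \<gamma> ys n"
  by (induction n) auto

text \<open>The law that defines the predictor plays a fixed word of actions, whatever is observed.\<close>

lemma actions_open_loop: "n \<le> length us \<Longrightarrow> actions (\<lambda>_ vs. us ! length vs) ys n = take n us"
  by (induction n) (auto simp: take_Suc_conv_app_nth)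

context pomdp
begin

lemma measurable_step [measurable]:
  "(\<lambda>h. T (fst h, \<gamma> (fst (snd h)) (snd (snd h))) \<bind> (\<lambda>x'. Q x' \<bind> (\<lambda>y'.
      return hist_algebra (x', fst (snd h) @ [y'], snd (snd h) @ [\<gamma> (fst (snd h)) (snd (snd h))]))))
   \<in> hist_algebra \<rightarrow>\<^sub>M subprob_algebra hist_algebra"
proof -
  have *: "(\<lambda>h. \<gamma> (fst (snd h)) (snd (snd h))) \<in> (hist_algebra :: ('x \<times> 'y list \<times> 'u list) measure) \<rightarrow>\<^sub>M count_space UNIV"
    by (intro measurable_discrete2[where h=\<gamma>]) measurable
  have 1: "(\<lambda>h. T (fst h, \<gamma> (fst (snd h)) (snd (snd h)))) \<in> hist_algebra \<rightarrow>\<^sub>M subprob_algebra borel"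
    using * by measurable
  have 2: "(\<lambda>p. snd (snd (fst (fst p))) @ [\<gamma> (fst (snd (fst (fst p)))) (snd (snd (fst (fst p))))])
     \<in> ((hist_algebra :: ('x \<times> 'y list \<times> 'u list) measure) \<Otimes>\<^sub>M (borel :: 'x measure)) \<Otimes>\<^sub>M (count_space UNIV :: 'y measure) \<rightarrow>\<^sub>M count_space UNIV"
    by (intro measurable_discrete2[where h="\<lambda>ys us. us @ [\<gamma> ys us]"]) measurable
  have 3: "(\<lambda>p. fst (snd (fst (fst p))) @ [snd p])
     \<in> ((hist_algebra :: ('x \<times> 'y list \<times> 'u list) measure) \<Otimes>\<^sub>M (borel :: 'x measure)) \<Otimes>\<^sub>M (count_space UNIV :: 'y measure) \<rightarrow>\<^sub>M count_space UNIV"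
    by (intro measurable_discrete2[where h="\<lambda>ys y. ys @ [y]"]) measurable
  show ?thesis
    by (intro measurable_bind[OF 1] measurable_bind[where N = "count_space UNIV"]
        measurable_compose[OF _ return_measurable] measurable_Pair 2 3 
        measurable_compose[OF _ Q_subprob]) measurable
qed

lemma measurable_obs [measurable]:
  "(\<lambda>x. Q x \<bind> (\<lambda>y. return hist_algebra (x, ys @ [y], us))) \<in> borel \<rightarrow>\<^sub>M subprob_algebra hist_algebra"
  by (intro measurable_bind[where N = "count_space UNIV"] measurable_compose[OF _ return_measurable]) measurable

lemma sets_joint_law: "z \<in> space (prob_algebra borel) \<Longrightarrow> sets (joint_law T Q z \<gamma> n) = sets hist_algebra"
proof (induction n)
  case 0
  then have "sets z = sets borel" "space z = UNIV"
    using sets_eq_imp_space_eq[of z borel] by (auto simp: space_prob_algebra)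
  then show ?case
    using sets_kernel[OF measurable_obs[of "[]" "[]"]] by (auto simp: sets_bind[where N = hist_algebra])
next
  case (Suc n)
  then have 1: "sets (joint_law T Q z \<gamma> n) = sets hist_algebra" by simp
  then have 2: "space (joint_law T Q z \<gamma> n) = UNIV"
    using sets_eq_imp_space_eq[of "joint_law T Q z \<gamma> n" hist_algebra] by (simp add: space_pair_measure)
  show ?case
    using sets_kernel[OF measurable_step[of \<gamma>]] 2
    by (auto simp: split_beta sets_bind[where N = hist_algebra] space_pair_measure)
qed

lemma nn_integral_obs:
  assumes [measurable]: "f \<in> borel_measurable hist_algebra"
  shows "(\<integral>\<^sup>+h. f h \<partial>(Q x \<bind> (\<lambda>y. return hist_algebra (x, ys @ [y], us)))) =
           (\<Sum>y\<in>UNIV. ennreal (lik y x) * f (x, ys @ [y], us))"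
proof -
  have "(\<lambda>y. return hist_algebra (x, ys @ [y], us)) \<in> Q x \<rightarrow>\<^sub>M subprob_algebra hist_algebra"
    by (simp add: space_pair_measure subprob_space_return_ne measurable_def space_subprob_algebra subprob_space_return)
  then show ?thesis
    by (subst nn_integral_bind[where B = hist_algebra])
       (auto simp: nn_integral_Q nn_integral_return space_pair_measure)
qed

lemma nn_integral_sum_density_lik:
  assumes "sets z = sets borel" and f: "\<And>y. f y \<in> borel_measurable borel"
  shows "(\<integral>\<^sup>+x. (\<Sum>y\<in>UNIV. ennreal (lik y x) * f y x) \<partial>z) = (\<Sum>y\<in>UNIV. \<integral>\<^sup>+x. f y x \<partial>density z (lik y))"
proof -
  note assms(1)[measurable_cong] f[measurable]
  show ?thesis
    by (subst nn_integral_sum) (auto simp: nn_integral_density)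
qed

text \<open>The law of the history decomposes over the finitely many observation words, and on the event that
the word \<open>ys\<close> is observed the law of the state is the unnormalized filter. The policy enters only
through the actions it plays, never through the weights. In the induction step the next
observation is split off by \<open>nn_integral_sum_density_lik\<close>.\<close>

lemma nn_integral_joint_law:
  assumes z: "z \<in> space (prob_algebra borel)" and f: "f \<in> borel_measurable hist_algebra"
  shows "(\<integral>\<^sup>+h. f h \<partial>joint_law T Q z \<gamma> n) =
           (\<Sum>ys | length ys = Suc n. \<integral>\<^sup>+x. f (x, ys, actions \<gamma> ys n) \<partial>unfilt z ((!) ys) ((!) (actions \<gamma> ys n)) n)"
  using f
proof (induction n arbitrary: f)
  case 0
  note 0[measurable]
  have sz: "sets z = sets borel" using z by (simp add: space_prob_algebra)
  note sz[measurable_cong]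
  have "(\<integral>\<^sup>+h. f h \<partial>joint_law T Q z \<gamma> 0) = (\<integral>\<^sup>+x. (\<Sum>y\<in>UNIV. ennreal (lik y x) * f (x, [y], [])) \<partial>z)"
    using nn_integral_obs[OF 0, of _ "[]" "[]"] measurable_obs[of "[]" "[]"]
    by (simp add: nn_integral_bind[where B = hist_algebra])
  also have "\<dots> = (\<Sum>y\<in>UNIV. \<integral>\<^sup>+x. f (x, [y], []) \<partial>density z (lik y))"
    by (intro nn_integral_sum_density_lik sz) measurable
  finally show ?case by (simp add: sum_lists_snoc unfilt_def)
next
  case (Suc n)
  note Suc.prems[measurable]
  let ?J = "joint_law T Q z \<gamma> n"
  note sets_joint_law[OF z, of \<gamma> n, measurable_cong]
  have sz: "sets z = sets borel" using z by (simp add: space_prob_algebra)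
  define G where "G = (\<lambda>(x, ys, us). \<integral>\<^sup>+x'. (\<Sum>y\<in>UNIV. ennreal (lik y x') * f (x', ys @ [y], us @ [\<gamma> ys us])) \<partial>T (x, \<gamma> ys us))"
  let ?K = "\<lambda>h. T (fst h, \<gamma> (fst (snd h)) (snd (snd h))) \<bind> (\<lambda>x'. Q x' \<bind> (\<lambda>y'.
      return hist_algebra (x', fst (snd h) @ [y'], snd (snd h) @ [\<gamma> (fst (snd h)) (snd (snd h))])))"
  have K: "(\<integral>\<^sup>+h'. f h' \<partial>?K h) = G h" for h
    using nn_integral_obs[OF Suc.prems] 
    by (subst nn_integral_bind[where B = hist_algebra])
       (auto simp: G_def split_beta measurable_cong_sets[OF sets_T refl] intro!: measurable_obs)
  have G: "G \<in> borel_measurable hist_algebra"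
    unfolding K[symmetric]
    using measurable_compose[OF measurable_step nn_integral_measurable_subprob_algebra[OF Suc.prems], of \<gamma>]
    by (simp add: K)
  have "(\<integral>\<^sup>+h. f h \<partial>joint_law T Q z \<gamma> (Suc n)) = (\<integral>\<^sup>+h. G h \<partial>?J)"
    unfolding K[symmetric] by (simp add: split_beta nn_integral_bind[where B = hist_algebra])
  also have "\<dots> = (\<Sum>ys | length ys = Suc n. \<integral>\<^sup>+x. G (x, ys, actions \<gamma> ys n) \<partial>unfilt z ((!) ys) ((!) (actions \<gamma> ys n)) n)"
    by (rule Suc.IH[OF G])
  also have "\<dots> = (\<Sum>ys | length ys = Suc n. \<Sum>y\<in>UNIV. \<integral>\<^sup>+x. f (x, ys @ [y], actions \<gamma> (ys @ [y]) (Suc n))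
       \<partial>unfilt z ((!) (ys @ [y])) ((!) (actions \<gamma> (ys @ [y]) (Suc n))) (Suc n))"
  proof (intro sum.cong refl)
    fix ys :: "'y list" assume "ys \<in> {ys. length ys = Suc n}"
    then have l: "length ys = Suc n" by simp
    let ?us = "actions \<gamma> ys n" let ?u = "\<gamma> ys ?us"
    let ?m = "unfilt z ((!) ys) ((!) ?us) n"
    have sm: "sets ?m = sets borel" using sz by simp
    note sm[measurable_cong]
    have "(\<integral>\<^sup>+x. G (x, ys, ?us) \<partial>?m) =
      (\<integral>\<^sup>+x'. (\<Sum>y\<in>UNIV. ennreal (lik y x') * f (x', ys @ [y], ?us @ [?u])) \<partial>(?m \<bind> (\<lambda>x. T (x, ?u))))"
      unfolding G_def by (subst nn_integral_bind[where B = borel]) auto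
    also have "\<dots> = (\<Sum>y\<in>UNIV. \<integral>\<^sup>+x'. f (x', ys @ [y], ?us @ [?u]) \<partial>density (?m \<bind> (\<lambda>x. T (x, ?u))) (lik y))"
      by (intro nn_integral_sum_density_lik) (auto simp: sz)
    also have "\<dots> = (\<Sum>y\<in>UNIV. \<integral>\<^sup>+x'. f (x', ys @ [y], ?us @ [?u])
        \<partial>unfilt z ((!) (ys @ [y])) ((!) (actions \<gamma> (ys @ [y]) (Suc n))) (Suc n))"
    proof (intro sum.cong refl)
      fix y :: 'y
      have "?m = unfilt z ((!) (ys @ [y])) ((!) (?us @ [?u])) n"
        by (rule unfilt_cong) (auto simp: l nth_append)
      then have "density (?m \<bind> (\<lambda>x. T (x, ?u))) (lik y) = unfilt z ((!) (ys @ [y])) ((!) (?us @ [?u])) (Suc n)"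
        by (simp add: unfilt_def[of _ _ _ "Suc n"] unpred_Suc nth_append l del: unpred.simps(2))
      then show "(\<integral>\<^sup>+x'. f (x', ys @ [y], ?us @ [?u]) \<partial>density (?m \<bind> (\<lambda>x. T (x, ?u))) (lik y)) =
        (\<integral>\<^sup>+x'. f (x', ys @ [y], ?us @ [?u]) \<partial>unfilt z ((!) (ys @ [y])) ((!) (actions \<gamma> (ys @ [y]) (Suc n))) (Suc n))"
        by (simp add: l)
    qed
    finally show "(\<integral>\<^sup>+x. G (x, ys, ?us) \<partial>?m) = (\<Sum>y\<in>UNIV. \<integral>\<^sup>+x. f (x, ys @ [y], actions \<gamma> (ys @ [y]) (Suc n))
       \<partial>unfilt z ((!) (ys @ [y])) ((!) (actions \<gamma> (ys @ [y]) (Suc n))) (Suc n))"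
      by (simp add: l)
  qed
  also have "\<dots> = (\<Sum>ys | length ys = Suc (Suc n). \<integral>\<^sup>+x. f (x, ys, actions \<gamma> ys (Suc n))
       \<partial>unfilt z ((!) ys) ((!) (actions \<gamma> ys (Suc n))) (Suc n))"
    by (rule sum_lists_snoc[symmetric])
  finally show ?case .
qed

text \<open>Stated as a product the normalization also makes sense for observations of probability \<open>0\<close>: both
sides are then the zero measure, whatever the fallback \<open>\<rho>\<close> is.\<close>

lemma
  assumes z: "z \<in> space (prob_algebra borel)"
  shows bayes_update_prob: "bayes_update Q \<rho> z y \<in> space (prob_algebra borel)"
    and density_lik_eq_bayes_update: "density z (lik y) = scale_measure (emeasure (density z (lik y)) UNIV) (bayes_update Q \<rho> z y)"
proof -
  have sz: "sets z = sets borel" and "prob_space z" using z by (auto simp: space_prob_algebra)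
  note sz[measurable_cong]
  interpret prob_space z by fact
  define m where "m = (\<integral>x. lik y x \<partial>z)"
  have "integrable z (lik y)"
    by (rule integrable_const_bound[where B = 1]) (auto simp: lik_le_1)
  then have m: "(\<integral>\<^sup>+x. ennreal (lik y x) \<partial>z) = ennreal m"
    unfolding m_def by (intro nn_integral_eq_integral) auto
  have m0: "0 \<le> m" unfolding m_def by simp
  have e: "emeasure (density z (lik y)) UNIV = ennreal m"
    using sz by (simp add: emeasure_density m)
  have b: "bayes_update Q \<rho> z y = (if m = 0 then \<rho> else density z (\<lambda>x. ennreal (lik y x / m)))"
    by (simp add: bayes_update_def m_def)
  have d: "scale_measure (ennreal m) (density z (\<lambda>x. ennreal (lik y x / m))) = density z (lik y)" if "m \<noteq> 0"
  proof (rule measure_eqI)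
    fix A assume "A \<in> sets (scale_measure (ennreal m) (density z (\<lambda>x. ennreal (lik y x / m))))"
    then have [measurable]: "A \<in> sets z" by simp
    show "emeasure (scale_measure (ennreal m) (density z (\<lambda>x. ennreal (lik y x / m)))) A = emeasure (density z (lik y)) A"
      using that m0 by (simp add: emeasure_density nn_integral_cmult[symmetric] mult.assoc[symmetric] ennreal_mult[symmetric])
  qed simp
  show "density z (lik y) = scale_measure (emeasure (density z (lik y)) UNIV) (bayes_update Q \<rho> z y)"
  proof (cases "m = 0")
    case True
    have "emeasure (density z (lik y)) A = 0" for A
      using emeasure_mono[of A UNIV "density z (lik y)"] e True sz
      by (cases "A \<in> sets (density z (lik y))") (auto simp: emeasure_notin_sets)
    then show ?thesis
      using \<rho>_prob sz by (intro measure_eqI) (auto simp: b True space_prob_algebra e)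
  qed (simp add: e b d)
  show "bayes_update Q \<rho> z y \<in> space (prob_algebra borel)"
  proof (cases "m = 0")
    case False
    have "emeasure (density z (lik y)) UNIV = ennreal m * emeasure (density z (\<lambda>x. ennreal (lik y x / m))) UNIV"
      using d[OF False] by (metis emeasure_scale_measure)
    then have "ennreal m * emeasure (density z (\<lambda>x. ennreal (lik y x / m))) UNIV = ennreal m * 1"
      using e by simp
    then have "emeasure (density z (\<lambda>x. ennreal (lik y x / m))) UNIV = 1"
      using False m0 by (subst (asm) ennreal_mult_cancel_left) auto
    then show ?thesis
      using False sz sets_eq_imp_space_eq[OF sz] by (auto simp: b space_prob_algebra intro!: prob_spaceI)
  qed (simp add: b \<rho>_prob)
qed

lemma bind_T_prob: "z \<in> space (prob_algebra borel) \<Longrightarrow> z \<bind> (\<lambda>x. T (x, u)) \<in> space (prob_algebra borel)"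
  using sets_eq_imp_space_eq[of "z \<bind> (\<lambda>x. T (x, u))" borel] emeasure_bind_T_UNIV[of z u]
     sets_eq_imp_space_eq[of z borel] prob_space.emeasure_space_1[of z]
  by (auto simp: space_prob_algebra intro!: prob_spaceI)

lemma posterior_prob: "z \<in> space (prob_algebra borel) \<Longrightarrow> posterior T Q \<rho> z y u k \<in> space (prob_algebra borel)"
  by (induction k) (auto intro: bayes_update_prob bind_T_prob)

text \<open>The normalizing constants of the successive Bayes updates multiply up to the mass of the
unnormalized filter.\<close>

lemma unfilt_eq_posterior:
  assumes z: "z \<in> space (prob_algebra borel)"
  shows "unfilt z y u k = scale_measure (emeasure (unfilt z y u k) UNIV) (posterior T Q \<rho> z y u k)"
proof (induction k)
  case 0
  show ?case using density_lik_eq_bayes_update[OF z] by (simp add: unfilt_def)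
next
  case (Suc k)
  let ?p = "posterior T Q \<rho> z y u k" and ?c = "emeasure (unfilt z y u k) UNIV"
  let ?q = "?p \<bind> (\<lambda>x. T (x, u k))"
  have q: "?q \<in> space (prob_algebra borel)" by (intro bind_T_prob posterior_prob z)
  have s: "sets ?p = sets borel" "sets ?q = sets borel" using posterior_prob[OF z, of y u k] q by (auto simp: space_prob_algebra)
  have "unfilt z y u (Suc k) = scale_measure ?c (density ?q (lik (y (Suc k))))"
    unfolding unfilt_def[of _ _ _ "Suc k"] unpred_Suc
    by (subst Suc.IH) (simp add: bind_T_scale s density_lik_scale del: posterior.simps)
  moreover have "density ?q (lik (y (Suc k))) = scale_measure (emeasure (density ?q (lik (y (Suc k)))) UNIV) (posterior T Q \<rho> z y u (Suc k))"
    using density_lik_eq_bayes_update[OF q, of "y (Suc k)"] by simp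
  ultimately show ?case by (metis emeasure_scale_measure scale_scale_measure)
qed

text \<open>The conditioning event fixes all observations but the last; summing the unnormalized filter over
that last observation gives back the unnormalized predictor.\<close>

lemma
  assumes z: "z \<in> space (prob_algebra borel)"
  shows predictor_prob: "predictor T Q \<rho> z ys us \<in> space (prob_algebra borel)"
    and unpred_eq_predictor: "length ys = length us \<Longrightarrow>
      unpred z ((!) ys) ((!) us) (length us) =
        scale_measure (emeasure (unpred z ((!) ys) ((!) us) (length us)) UNIV) (predictor T Q \<rho> z ys us)"
proof -
  let ?n = "length us"
  define J where "J = joint_law T Q z (\<lambda>_ vs. us ! length vs) ?n"
  define E :: "('x \<times> 'y list \<times> 'u list) set" where "E = {(x, ys', us'). butlast ys' = ys \<and> us' = us}"
  have sz: "sets z = sets borel" and pz: "prob_space z" using z by (auto simp: space_prob_algebra)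
  have sJ: "sets J = sets hist_algebra" unfolding J_def by (rule sets_joint_law[OF z])
  have spJ: "space J = UNIV" using sets_eq_imp_space_eq[OF sJ] by (simp add: space_pair_measure)
  note sJ[measurable_cong]
  have E_prod: "E \<inter> fst -` B = B \<times> ({ys'. butlast ys' = ys} \<times> {us})" for B
    by (auto simp: E_def)
  have meas: "E \<inter> fst -` B \<in> sets hist_algebra" if "B \<in> sets borel" for B
    unfolding E_prod using that by (intro pair_measureI) auto
  have eJ: "emeasure J A = (\<Sum>ys' | length ys' = Suc ?n. emeasure (unfilt z ((!) ys') ((!) us) ?n) {x. (x, ys', us) \<in> A})"
    if A: "A \<in> sets hist_algebra" for A
  proof -
    have A': "{x. (x, ys', us) \<in> A} \<in> sets borel" for ys'
    proof -
      have "(\<lambda>x. (x, ys', us)) \<in> borel \<rightarrow>\<^sub>M hist_algebra" by measurable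
      from measurable_sets[OF this A] show ?thesis by (simp add: vimage_def)
    qed
    have "emeasure J A = (\<integral>\<^sup>+h. indicator A h \<partial>J)" using A sJ by simp
    also have "\<dots> = (\<Sum>ys' | length ys' = Suc ?n. \<integral>\<^sup>+x. indicator A (x, ys', us) \<partial>unfilt z ((!) ys') ((!) us) ?n)"
      unfolding J_def using A by (subst nn_integral_joint_law[OF z]) (auto simp: actions_open_loop)
    also have "\<dots> = (\<Sum>ys' | length ys' = Suc ?n. emeasure (unfilt z ((!) ys') ((!) us) ?n) {x. (x, ys', us) \<in> A})"
    proof (intro sum.cong refl)
      fix ys' :: "'y list"
      have "(\<lambda>x. indicator A (x, ys', us) :: ennreal) = indicator {x. (x, ys', us) \<in> A}"
        by (auto simp: indicator_def)
      then show "(\<integral>\<^sup>+x. indicator A (x, ys', us) \<partial>unfilt z ((!) ys') ((!) us) ?n) = emeasure (unfilt z ((!) ys') ((!) us) ?n) {x. (x, ys', us) \<in> A}"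
        using A' sz by simp
    qed
    finally show ?thesis .
  qed
  have finJ: "emeasure J A \<noteq> \<infinity>" for A
  proof (cases "A \<in> sets hist_algebra")
    case True
    have "emeasure (unfilt z y u n) B < \<infinity>" for y u n B
      using emeasure_unfilt_le(1)[OF sz, of y u n] emeasure_mono[of B UNIV "unfilt z y u n"] sz
        prob_space.emeasure_space_1[OF pz] sets_eq_imp_space_eq[OF sz]
      by (cases "B \<in> sets (unfilt z y u n)") (auto simp: emeasure_notin_sets less_top[symmetric] top_unique dest: order_trans)
    moreover have "finite {ys' :: 'y list. length ys' = Suc ?n}"
      using finite_lists_length_eq[of "UNIV :: 'y set" "Suc ?n"] by simp
    ultimately show ?thesis by (auto simp: eJ[OF True] less_top)
  qed (use sJ in \<open>simp add: emeasure_notin_sets\<close>)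
  have EJ: "E \<in> sets J" using meas[of UNIV] sJ by simp
  have pr: "predictor T Q \<rho> z ys us = (if us = [] then z else if measure J E = 0 then \<rho> else distr (uniform_measure J E) borel fst)"
    by (simp add: predictor_def J_def E_def Let_def)
  have m0: "measure J E = 0 \<longleftrightarrow> emeasure J E = 0"
    using finJ[of E] by (simp add: measure_def enn2real_eq_0_iff)
  show "predictor T Q \<rho> z ys us \<in> space (prob_algebra borel)"
  proof -
    have "distr (uniform_measure J E) borel fst \<in> space (prob_algebra borel)" if "emeasure J E \<noteq> 0"
    proof -
      interpret prob_space "uniform_measure J E" using that finJ by (rule prob_space_uniform_measure)
      have "fst \<in> uniform_measure J E \<rightarrow>\<^sub>M borel" by measurable
      from prob_space_distr[OF this] show ?thesis by (simp add: space_prob_algebra)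
    qed
    then show ?thesis using z \<rho>_prob m0 by (simp add: pr)
  qed
  assume l: "length ys = length us"
  let ?P = "unpred z ((!) ys) ((!) us) ?n"
  have eE: "emeasure J (E \<inter> fst -` B) = emeasure ?P B" if B: "B \<in> sets borel" for B
  proof -
    have fin: "finite {ys' :: 'y list. length ys' = ?n}" using finite_lists_length_eq[of "UNIV :: 'y set" ?n] by simp
    have "emeasure J (E \<inter> fst -` B) = (\<Sum>ys' | length ys' = ?n. \<Sum>y\<in>UNIV. 
        emeasure (unfilt z ((!) (ys' @ [y])) ((!) us) ?n) {x. (x, ys' @ [y], us) \<in> E \<inter> fst -` B})"
      unfolding eJ[OF meas[OF B]] by (rule sum_lists_snoc)
    also have "\<dots> = (\<Sum>ys' | length ys' = ?n. if ys' = ys then (\<Sum>y\<in>UNIV. 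
        emeasure (unfilt z ((!) (ys @ [y])) ((!) us) ?n) B) else 0)"
      by (intro sum.cong refl) (auto simp: E_def)
    also have "\<dots> = (\<Sum>y\<in>UNIV. emeasure (unfilt z ((!) (ys @ [y])) ((!) us) ?n) B)"
      using fin l by simp
    also have "\<dots> = (\<Sum>y\<in>UNIV. emeasure (density ?P (lik y)) B)"
    proof (intro sum.cong refl)
      fix y
      have "unpred z ((!) (ys @ [y])) ((!) us) ?n = ?P" by (rule unpred_cong) (auto simp: nth_append l)
      then show "emeasure (unfilt z ((!) (ys @ [y])) ((!) us) ?n) B = emeasure (density ?P (lik y)) B"
        by (simp add: unfilt_def nth_append l)
    qed
    also have "\<dots> = emeasure ?P B" using sz B by (intro density_lik_sum) auto
    finally show ?thesis .
  qed
  have EU: "emeasure J E = emeasure ?P UNIV" using eE[of UNIV] by simp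
  show "?P = scale_measure (emeasure ?P UNIV) (predictor T Q \<rho> z ys us)"
  proof (cases "us = [] \<or> emeasure J E = 0")
    case True
    then consider "us = []" | "us \<noteq> []" "emeasure J E = 0" by auto
    then show ?thesis
    proof cases
      case 1
      then show ?thesis using prob_space.emeasure_space_1[OF pz] sets_eq_imp_space_eq[OF sz]
        by (simp add: predictor_def)
    next
      case 2
      have "emeasure ?P A = 0" for A
        using emeasure_mono[of A UNIV ?P] 2 EU sz by (cases "A \<in> sets ?P") (auto simp: emeasure_notin_sets)
      then show ?thesis
        using \<rho>_prob sz 2 m0 EU by (intro measure_eqI) (auto simp: pr space_prob_algebra)
    qed
  next
    case False
    then have d: "predictor T Q \<rho> z ys us = distr (uniform_measure J E) borel fst" using m0 by (simp add: pr)
    show ?thesis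
    proof (rule measure_eqI)
      show "sets ?P = sets (scale_measure (emeasure ?P UNIV) (predictor T Q \<rho> z ys us))"
        using sz by (simp add: d)
      fix B assume "B \<in> sets ?P"
      then have B: "B \<in> sets borel" using sz by simp
      have "fst \<in> J \<rightarrow>\<^sub>M borel" by measurable
      from measurable_sets[OF this B] have vB: "fst -` B \<in> sets J" by (simp add: spJ)
      have f: "fst \<in> uniform_measure J E \<rightarrow>\<^sub>M borel" by measurable
      have "emeasure (predictor T Q \<rho> z ys us) B = emeasure J (E \<inter> fst -` B) / emeasure J E"
        unfolding d using EJ vB spJ by (simp add: emeasure_distr[OF f B])
      also have "\<dots> = emeasure ?P B / emeasure ?P UNIV" by (simp add: eE[OF B] EU)
      finally show "emeasure ?P B = emeasure (scale_measure (emeasure ?P UNIV) (predictor T Q \<rho> z ys us)) B"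
        using False finJ[of E] EU by (simp add: ennreal_divide_times ennreal_times_divide ennreal_mult_divide_eq mult.commute)
    qed
  qed
qed

end

section \<open>Total variation and Wasserstein distance\<close>

lemma integral_scale_measure_nonneg:
  assumes [measurable]: "f \<in> borel_measurable M" and "\<And>x. 0 \<le> f x"
  shows "integral\<^sup>L (scale_measure r M) f = enn2real r * integral\<^sup>L M (f :: _ \<Rightarrow> real)"
proof -
  have [measurable]: "f \<in> borel_measurable (scale_measure r M)" by measurable
  show ?thesis
    using assms(2) by (subst (1 2) integral_eq_nn_integral) (auto simp: nn_integral_scale_measure enn2real_mult)
qed

lemma integrable_bounded_prob:
  assumes "prob_space M" "f \<in> borel_measurable M" "\<And>x. \<bar>f x\<bar> \<le> B"
  shows "integrable M (f :: _ \<Rightarrow> real)"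
proof -
  interpret prob_space M by fact
  show ?thesis using assms(2,3) by (intro integrable_const_bound[of _ B]) auto
qed

lemma integral_bind_nonneg:
  fixes f :: "'b \<Rightarrow> real"
  assumes M: "prob_space M" and K: "K \<in> M \<rightarrow>\<^sub>M prob_algebra N"
    and f: "f \<in> borel_measurable N" "\<And>x. 0 \<le> f x" "\<And>x. f x \<le> B"
  shows "integral\<^sup>L (M \<bind> K) f = (\<integral>x. integral\<^sup>L (K x) f \<partial>M)"
    and "(\<lambda>x. integral\<^sup>L (K x) f) \<in> borel_measurable M"
proof -
  interpret prob_space M by fact
  note K' = measurable_prob_algebraD[OF K]
  have sK: "sets (K x) = sets N" "prob_space (K x)" if "x \<in> space M" for x
    using measurable_space[OF K that] by (auto simp: space_prob_algebra)
  have sets: "sets (M \<bind> K) = sets N" using sK not_empty by (intro sets_bind) auto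
  show m: "(\<lambda>x. integral\<^sup>L (K x) f) \<in> borel_measurable M"
    using measurable_compose[OF K' integral_measurable_subprob_algebra[OF f(1)]] .
  have *: "(\<integral>\<^sup>+y. f y \<partial>K x) = ennreal (integral\<^sup>L (K x) f)" if "x \<in> space M" for x
  proof (rule nn_integral_eq_integral)
    have "f \<in> borel_measurable (K x)" using f(1) sK(1)[OF that] by (simp cong: measurable_cong_sets)
    then show "integrable (K x) f"
      using f(2,3) by (intro integrable_bounded_prob[of _ _ B] sK that) (simp_all add: abs_of_nonneg)
  qed (simp add: f)
  have "integral\<^sup>L (M \<bind> K) f = enn2real (\<integral>\<^sup>+x. f x \<partial>(M \<bind> K))"
    using f sets by (intro integral_eq_nn_integral) (auto cong: measurable_cong_sets)
  also have "(\<integral>\<^sup>+x. f x \<partial>(M \<bind> K)) = (\<integral>\<^sup>+x. \<integral>\<^sup>+y. f y \<partial>K x \<partial>M)"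
    using f by (intro nn_integral_bind[OF _ K']) auto
  also have "\<dots> = (\<integral>\<^sup>+x. ennreal (integral\<^sup>L (K x) f) \<partial>M)"
    by (intro nn_integral_cong *)
  also have "enn2real \<dots> = (\<integral>x. integral\<^sup>L (K x) f \<partial>M)"
    using m f by (intro integral_eq_nn_integral[symmetric]) auto
  finally show "integral\<^sup>L (M \<bind> K) f = (\<integral>x. integral\<^sup>L (K x) f \<partial>M)" .
qed

text \<open>Differences of integrals against probability measures do not see additive constants, so a function
of oscillation at most \<open>L\<close> may be assumed to have values in \<open>[0, L]\<close>.\<close>

lemma shift_into_interval:
  fixes f :: "'a \<Rightarrow> real"
  assumes "\<And>x x'. f x - f x' \<le> L"
  obtains c where "\<And>x. 0 \<le> f x - c" "\<And>x. f x - c \<le> L"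
proof
  have b: "bdd_below (range f)"
    using assms[of undefined] by (intro bdd_belowI[of _ "f undefined - L"]) (auto simp: algebra_simps)
  show "0 \<le> f x - Inf (range f)" for x using cINF_lower[OF b, of x] by simp
  have "f x - L \<le> Inf (range f)" for x
    using assms[of x] by (intro cINF_greatest) (auto simp: algebra_simps)
  then show "f x - Inf (range f) \<le> L" for x by (smt (verit))
qed

lemma tv_dist_bound:
  assumes "prob_space \<mu>" "prob_space \<nu>" "B \<in> sets borel"
  shows "\<bar>measure \<mu> B - measure \<nu> B\<bar> \<le> tv_dist \<mu> \<nu> / 2"
proof -
  have "\<bar>measure \<mu> A - measure \<nu> A\<bar> \<le> 1" for A
    using prob_space.prob_le_1[OF assms(1), of A] prob_space.prob_le_1[OF assms(2), of A]
      measure_nonneg[of \<mu> A] measure_nonneg[of \<nu> A] by linarith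
  then have "bdd_above ((\<lambda>B. \<bar>measure \<mu> B - measure \<nu> B\<bar>) ` sets borel)"
    by (intro bdd_aboveI[of _ 1]) auto
  from cSUP_upper[OF assms(3) this] show ?thesis by (simp add: tv_dist_def)
qed

text \<open>A discretized layer-cake argument: up to an error \<open>1 / n\<close>, \<open>f\<close> is the average of the indicators of
its \<open>n\<close> superlevel sets at the heights \<open>k / n\<close>, and on each of these sets the two measures differ
by at most half of the total variation norm.\<close>

lemma integral_diff_le_tv_unit:
  fixes f :: "'x::topological_space \<Rightarrow> real"
  assumes \<mu>: "prob_space \<mu>" "sets \<mu> = sets borel" and \<nu>: "prob_space \<nu>" "sets \<nu> = sets borel"
    and f[measurable]: "f \<in> borel_measurable borel" and f0: "\<And>x. 0 \<le> f x" and f1: "\<And>x. f x \<le> 1"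
  shows "integral\<^sup>L \<mu> f - integral\<^sup>L \<nu> f \<le> tv_dist \<mu> \<nu> / 2"
proof -
  let ?s = "tv_dist \<mu> \<nu> / 2"
  note \<mu>(2)[measurable_cong] \<nu>(2)[measurable_cong]
  have approx: "integral\<^sup>L \<mu> f - integral\<^sup>L \<nu> f \<le> ?s + 1 / real (Suc m)" for m
  proof -
    let ?n = "Suc m"
    define A where "A k = {x. real k \<le> real ?n * f x}" for k
    have A[measurable]: "A k \<in> sets borel" for k unfolding A_def by measurable
    define g where "g x = (\<Sum>k\<in>{1..?n}. indicat_real (A k) x) / ?n" for x
    have count: "(\<Sum>k\<in>{1..?n}. indicat_real (A k) x) = real (nat \<lfloor>real ?n * f x\<rfloor>)" for x
    proof -
      define j where "j = nat \<lfloor>real ?n * f x\<rfloor>"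
      have "real ?n * f x \<le> real ?n" using mult_left_mono[OF f1[of x], of "real ?n"] by simp
      then have le: "j \<le> ?n" unfolding j_def by linarith
      have "0 \<le> real ?n * f x" using f0 by simp
      then have "real k \<le> real ?n * f x \<longleftrightarrow> k \<le> j" for k unfolding j_def by linarith
      then have "x \<in> A k \<longleftrightarrow> k \<le> j" for k by (simp only: A_def mem_Collect_eq)
      then have "{k\<in>{1..?n}. x \<in> A k} = {k\<in>{1..?n}. k \<le> j}" by (simp only:)
      also have "\<dots> = {1..j}" using le by (intro set_eqI) (simp, linarith)
      finally have "card {k\<in>{1..?n}. x \<in> A k} = j" by simp
      moreover have "(\<Sum>k\<in>{1..?n}. indicat_real (A k) x) = real (card {k\<in>{1..?n}. x \<in> A k})"
        using sum.inter_filter[of "{1..?n}" "\<lambda>_. 1 :: real" "\<lambda>k. x \<in> A k"]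
        by (simp only: indicator_def of_bool_def finite_atLeastAtMost sum_constant mult_1_right if_distrib)
      ultimately show ?thesis by (simp add: j_def)
    qed
    have g: "g x \<le> f x" "f x \<le> g x + 1 / ?n" for x
    proof -
      have "0 \<le> real ?n * f x" using f0 by simp
      then have "real (nat \<lfloor>real ?n * f x\<rfloor>) \<le> real ?n * f x" "real ?n * f x \<le> real (nat \<lfloor>real ?n * f x\<rfloor>) + 1"
        by linarith+
      then show "g x \<le> f x" "f x \<le> g x + 1 / ?n"
        unfolding g_def count by (simp_all add: field_simps del: of_nat_Suc)
    qed
    have int: "integrable M f" "integrable M g" "integral\<^sup>L M g = (\<Sum>k\<in>{1..?n}. measure M (A k)) / ?n" 
       if "prob_space M" "sets M = sets borel" for M
    proof -
      interpret prob_space M by fact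
      note that(2)[measurable_cong]
      show "integrable M f" using f0 f1 by (intro integrable_bounded_prob[of _ _ 1] that) (simp_all add: abs_of_nonneg)
      show "integrable M g" unfolding g_def
        by (intro integrable_divide Bochner_Integration.integrable_sum integrable_real_indicator)
           (auto simp: less_top[symmetric])
      have "space M = UNIV" using sets_eq_imp_space_eq[OF that(2)] by simp
      then show "integral\<^sup>L M g = (\<Sum>k\<in>{1..?n}. measure M (A k)) / ?n"
        unfolding g_def
        by (subst integral_divide_zero, subst Bochner_Integration.integral_sum)
           (auto simp: less_top[symmetric] intro!: integrable_real_indicator)
    qed
    interpret M: prob_space \<mu> by fact
    have "integral\<^sup>L \<mu> f \<le> (\<integral>x. g x + 1 / ?n \<partial>\<mu>)"
      using int[OF \<mu>] g by (intro integral_mono) auto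
    also have "\<dots> = integral\<^sup>L \<mu> g + 1 / ?n"
      using int[OF \<mu>] by (subst Bochner_Integration.integral_add) (auto simp: M.prob_space)
    finally have "integral\<^sup>L \<mu> f \<le> integral\<^sup>L \<mu> g + 1 / ?n" .
    moreover have "integral\<^sup>L \<nu> g \<le> integral\<^sup>L \<nu> f"
      using int[OF \<nu>] g by (intro integral_mono) auto
    moreover have "integral\<^sup>L \<mu> g - integral\<^sup>L \<nu> g = (\<Sum>k\<in>{1..?n}. measure \<mu> (A k) - measure \<nu> (A k)) / ?n"
      by (simp only: int[OF \<mu>] int[OF \<nu>] sum_subtractf diff_divide_distrib)
    moreover have "\<dots> \<le> (\<Sum>k\<in>{1..?n}. ?s) / ?n"
      by (intro divide_right_mono sum_mono abs_le_D1[OF tv_dist_bound[OF \<mu>(1) \<nu>(1) A]]) simp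
    moreover have "\<dots> = ?s" by (simp del: of_nat_Suc)
    ultimately show ?thesis by linarith
  qed
  show ?thesis
  proof (rule field_le_epsilon)
    fix e :: real assume "0 < e"
    then obtain m where "1 / real (Suc m) < e" using nat_approx_posE by blast
    with approx[of m] show "integral\<^sup>L \<mu> f - integral\<^sup>L \<nu> f \<le> ?s + e" by linarith
  qed
qed

lemma integral_diff_le_tv:
  fixes f :: "'x::topological_space \<Rightarrow> real"
  assumes \<mu>: "prob_space \<mu>" "sets \<mu> = sets borel" and \<nu>: "prob_space \<nu>" "sets \<nu> = sets borel"
    and f[measurable]: "f \<in> borel_measurable borel" and f0: "\<And>x. 0 \<le> f x" and f1: "\<And>x. f x \<le> L"
  shows "integral\<^sup>L \<mu> f - integral\<^sup>L \<nu> f \<le> L * (tv_dist \<mu> \<nu> / 2)"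
proof (cases "L = 0")
  case True
  have "f x = 0" for x using f0[of x] f1[of x] True by simp
  then have "f = (\<lambda>_. 0)" by (rule ext)
  then show ?thesis using True by simp
next
  case False
  then have L: "0 < L" using f0[of undefined] f1[of undefined] by linarith
  have "integral\<^sup>L \<mu> (\<lambda>x. f x / L) - integral\<^sup>L \<nu> (\<lambda>x. f x / L) \<le> tv_dist \<mu> \<nu> / 2"
    using f0 f1 L by (intro integral_diff_le_tv_unit \<mu> \<nu>) auto
  then have "(integral\<^sup>L \<mu> f - integral\<^sup>L \<nu> f) / L \<le> tv_dist \<mu> \<nu> / 2"
    by (simp add: diff_divide_distrib)
  then show ?thesis using L by (simp add: divide_le_eq mult.commute)
qed

text \<open>The class of test functions in the definition of \<open>W1\<close>.\<close>

definition lip1 :: "('x::metric_space \<Rightarrow> real) set" where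
  "lip1 = {f. \<forall>x x'. \<bar>f x - f x'\<bar> \<le> dist x x'}"

text \<open>The parameter only names the type of points. Compactness makes the diameter finite, so that
1-Lipschitz functions are bounded and the suprema in \<open>W1\<close> are finite.\<close>

locale compact_space =
  fixes dummy :: "'x::metric_space itself"
  assumes compact_UNIV: "compact (UNIV :: 'x set)"
begin

lemma dist_le_diameter: "dist x (x' :: 'x) \<le> diameter (UNIV :: 'x set)"
  by (rule diameter_bounded_bound[OF compact_imp_bounded[OF compact_UNIV]]) simp_all

lemma diameter_UNIV_nonneg: "0 \<le> diameter (UNIV :: 'x set)"
  using dist_le_diameter[of undefined undefined] by simp

lemma lip1_measurable: "f \<in> lip1 \<Longrightarrow> f \<in> borel_measurable borel"
proof -
  assume f: "f \<in> lip1"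
  have "1-lipschitz_on UNIV f"
    using f by (intro lipschitz_onI) (auto simp: lip1_def dist_real_def)
  then show ?thesis
    by (rule borel_measurable_continuous_onI[OF lipschitz_on_continuous_on])
qed

lemma lip1_osc: "f \<in> lip1 \<Longrightarrow> f x - f (x' :: 'x) \<le> diameter (UNIV :: 'x set)"
proof -
  assume "f \<in> lip1"
  then have "\<bar>f x - f x'\<bar> \<le> dist x x'" by (simp add: lip1_def)
  with dist_le_diameter[of x x'] show ?thesis by linarith
qed

lemma lip1_integrable:
  fixes f :: "'x \<Rightarrow> real"
  assumes f: "f \<in> lip1" and M: "prob_space M" "sets M = sets borel"
  shows "integrable M f"
proof -
  note M(2)[measurable_cong] lip1_measurable[OF f, measurable]
  have "\<bar>f x\<bar> \<le> \<bar>f undefined\<bar> + diameter (UNIV :: 'x set)" for x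
    using lip1_osc[OF f, of x undefined] lip1_osc[OF f, of undefined x] by linarith
  then show ?thesis by (intro integrable_bounded_prob[OF M(1)]) auto
qed

lemma lip1_integral_diff_le:
  fixes f :: "'x \<Rightarrow> real"
  assumes f: "f \<in> lip1" and \<mu>: "prob_space \<mu>" "sets \<mu> = sets borel" and \<nu>: "prob_space \<nu>" "sets \<nu> = sets borel"
  shows "integral\<^sup>L \<mu> f - integral\<^sup>L \<nu> f \<le> diameter (UNIV :: 'x set)"
proof -
  interpret M: prob_space \<mu> by fact
  interpret N: prob_space \<nu> by fact
  obtain c where c: "\<And>x. 0 \<le> f x - c" "\<And>x. f x - c \<le> diameter (UNIV :: 'x set)"
    by (rule shift_into_interval[of f, OF lip1_osc[OF f]]) blast
  have le: "f x \<le> diameter (UNIV :: 'x set) + c" "c \<le> f x" for x using c[of x] by linarith+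
  have "integral\<^sup>L \<mu> f \<le> (\<integral>x. diameter (UNIV :: 'x set) + c \<partial>\<mu>)"
    by (rule integral_mono[OF lip1_integrable[OF f \<mu>] _ le(1)]) simp
  moreover have "(\<integral>x. c \<partial>\<nu>) \<le> integral\<^sup>L \<nu> f"
    by (rule integral_mono[OF _ lip1_integrable[OF f \<nu>] le(2)]) simp
  ultimately show ?thesis by (simp add: M.prob_space N.prob_space)
qed

lemma W1_upper:
  fixes f :: "'x \<Rightarrow> real"
  assumes f: "f \<in> lip1" and \<mu>: "prob_space \<mu>" "sets \<mu> = sets borel" and \<nu>: "prob_space \<nu>" "sets \<nu> = sets borel"
  shows "integral\<^sup>L \<mu> f - integral\<^sup>L \<nu> f \<le> W1 \<mu> \<nu>"
  unfolding W1_def using f lip1_integral_diff_le[OF _ \<mu> \<nu>]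
  by (intro cSUP_upper bdd_aboveI[of _ "diameter (UNIV :: 'x set)"]) (auto simp: lip1_def)

lemma W1_le:
  assumes "\<And>f. f \<in> lip1 \<Longrightarrow> integral\<^sup>L \<mu> f - integral\<^sup>L \<nu> f \<le> B"
  shows "W1 \<mu> \<nu> \<le> B"
  unfolding W1_def using assms by (intro cSUP_least) (auto simp: lip1_def intro!: exI[of _ "\<lambda>_. 0"])

lemma W1_approx:
  assumes "0 < e"
  obtains f where "f \<in> lip1" "W1 \<mu> \<nu> - e \<le> integral\<^sup>L \<mu> f - integral\<^sup>L \<nu> f"
proof (rule ccontr)
  assume "\<not> thesis"
  then have "W1 \<mu> \<nu> \<le> W1 \<mu> \<nu> - e" using that by (intro W1_le) force
  then show False using assms by simp
qed

lemma W1_nonneg: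
  assumes "prob_space \<mu>" "sets \<mu> = sets borel" "prob_space \<nu>" "sets \<nu> = sets borel"
  shows "0 \<le> W1 \<mu> (\<nu> :: 'x measure)"
  using W1_upper[of "\<lambda>_. 0", OF _ assms] by (simp add: lip1_def)

lemma W1_le_diameter:
  assumes "prob_space \<mu>" "sets \<mu> = sets borel" "prob_space \<nu>" "sets \<nu> = sets borel"
  shows "W1 \<mu> (\<nu> :: 'x measure) \<le> diameter (UNIV :: 'x set)"
  by (intro W1_le lip1_integral_diff_le assms)

text \<open>Rescaling of a Lipschitz test function; for \<open>a = 0\<close>, where one cannot divide, \<open>h\<close> is constant.\<close>

lemma lipschitz_integral_diff_le_W1:
  assumes \<mu>: "prob_space \<mu>" "sets \<mu> = sets borel" and \<nu>: "prob_space \<nu>" "sets \<nu> = sets borel"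
    and h: "\<And>x x'. h x - h x' \<le> a * dist x (x' :: 'x)" and a: "0 \<le> a"
  shows "integral\<^sup>L \<mu> h - integral\<^sup>L \<nu> h \<le> a * W1 \<mu> \<nu>"
proof (cases "a = 0")
  case True
  interpret M: prob_space \<mu> by fact
  interpret N: prob_space \<nu> by fact
  have "h x = h undefined" for x using h[of x undefined] h[of undefined x] True by simp
  then have "h = (\<lambda>_. h undefined)" by (rule ext)
  then have "integral\<^sup>L \<mu> h = integral\<^sup>L \<mu> (\<lambda>_. h undefined)" "integral\<^sup>L \<nu> h = integral\<^sup>L \<nu> (\<lambda>_. h undefined)" by simp_all
  then show ?thesis using True by (simp add: M.prob_space N.prob_space)
next
  case False
  then have a: "0 < a" using a by simp
  have "\<bar>h x - h x'\<bar> \<le> a * dist x x'" for x x'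
    using h[of x x'] h[of x' x] by (simp add: dist_commute abs_le_iff)
  then have "(\<lambda>x. h x / a) \<in> lip1"
    using a by (simp add: lip1_def divide_le_eq mult.commute flip: diff_divide_distrib)
  from W1_upper[OF this \<mu> \<nu>] show ?thesis
    using a by (simp add: divide_le_eq mult.commute flip: diff_divide_distrib)
qed

end

section \<open>Contraction of one prediction and update step\<close>

context pomdp
begin

text \<open>On a finite observation space the partition into singletons is among those over which the infimum
is taken.\<close>

lemma dobrushin_le: "dobrushin borel (count_space UNIV) Q \<le> (\<Sum>y\<in>UNIV. min (lik y x) (lik y x'))"
  unfolding dobrushin_def
proof (rule cInf_lower)
  have P: "partition_on UNIV (range (\<lambda>y :: 'y. {y}))"
    by (rule partition_onI) auto
  have "(\<Sum>y\<in>UNIV. min (lik y x) (lik y x')) = (\<Sum>A\<in>range (\<lambda>y. {y}). min (measure (Q x) A) (measure (Q x') A))"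
    by (subst sum.reindex) (auto simp: inj_def)
  then show "(\<Sum>y\<in>UNIV. min (lik y x) (lik y x')) \<in> {\<Sum>A\<in>P. min (measure (Q x) A) (measure (Q y) A) | x y P.
            x \<in> space borel \<and> y \<in> space borel \<and>
            finite P \<and> P \<subseteq> sets (count_space UNIV) \<and> partition_on (space (count_space UNIV)) P}"
    using P by (intro CollectI exI[of _ x] exI[of _ x'] exI[of _ "range (\<lambda>y. {y})"]) auto
qed (auto intro!: bdd_belowI[of _ 0] sum_nonneg)

lemma dobrushin_le_1: "dobrushin borel (count_space UNIV) Q \<le> 1"
proof -
  have "(\<Sum>y\<in>UNIV. min (lik y undefined) (lik y undefined)) = 1" by (simp add: sum_lik_UNIV)
  with dobrushin_le[of undefined undefined] show ?thesis by linarith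
qed

text \<open>The Dobrushin contraction: the common part \<open>min (lik y x) (lik y x')\<close> of two rows of the channel
cancels, and what is left has mass at most \<open>1 - \<delta>\<close>.\<close>

lemma mixture_osc_le:
  assumes "\<And>y. 0 \<le> k y" "\<And>y. k y \<le> L"
  shows "(\<Sum>y\<in>UNIV. lik y x * k y) - (\<Sum>y\<in>UNIV. lik y x' * k y)
           \<le> L * (1 - dobrushin borel (count_space UNIV) Q)"
proof -
  let ?m = "\<lambda>y. min (lik y x) (lik y x')"
  have L: "0 \<le> L" using assms[of undefined] by linarith
  have "lik y x * k y - lik y x' * k y \<le> (lik y x - ?m y) * L" for y
  proof -
    have "(lik y x - lik y x') * k y \<le> (lik y x - ?m y) * k y"
      using assms by (intro mult_right_mono) auto
    also have "\<dots> \<le> (lik y x - ?m y) * L"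
      using assms by (intro mult_left_mono) auto
    finally show ?thesis by (simp add: left_diff_distrib)
  qed
  then have "(\<Sum>y\<in>UNIV. lik y x * k y) - (\<Sum>y\<in>UNIV. lik y x' * k y) \<le> (\<Sum>y\<in>UNIV. (lik y x - ?m y) * L)"
    unfolding sum_subtractf[symmetric] by (rule sum_mono)
  also have "\<dots> = L * (1 - (\<Sum>y\<in>UNIV. ?m y))"
    by (simp add: sum_distrib_right[symmetric] sum_subtractf sum_lik_UNIV)
  also have "\<dots> \<le> L * (1 - dobrushin borel (count_space UNIV) Q)"
    using dobrushin_le[of x x'] L by (intro mult_left_mono) auto
  finally show ?thesis .
qed

text \<open>Bayes' rule in integrated form: weighting the update by the probability of the observation removes
the normalizing constant.\<close>

lemma integral_lik_mult:
  assumes z: "z \<in> space (prob_algebra borel)"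
    and g[measurable]: "g \<in> borel_measurable borel" and g0: "\<And>x. 0 \<le> g x"
  shows "(\<integral>x. lik y x * g x \<partial>z) = measure (density z (lik y)) UNIV * integral\<^sup>L (bayes_update Q \<rho> z y) g"
proof -
  have sz: "sets z = sets borel" using z by (simp add: space_prob_algebra)
  note sz[measurable_cong]
  have sb: "sets (bayes_update Q \<rho> z y) = sets borel" using bayes_update_prob[OF z] by (simp add: space_prob_algebra)
  note sb[measurable_cong]
  have "(\<integral>x. lik y x * g x \<partial>z) = integral\<^sup>L (density z (lik y)) g"
    by (subst integral_density) auto
  also have "\<dots> = measure (density z (lik y)) UNIV * integral\<^sup>L (bayes_update Q \<rho> z y) g"
    by (subst density_lik_eq_bayes_update[OF z]) (subst integral_scale_measure_nonneg, auto simp: g0 measure_def)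
  finally show ?thesis .
qed

end

locale regular_pomdp = pomdp T Q \<rho> + compact_space "TYPE('x)"
  for T :: "'x::metric_space \<times> 'u::finite \<Rightarrow> 'x measure"
    and Q :: "'x \<Rightarrow> 'y::finite measure"
    and \<rho> :: "'x measure" +
  fixes \<alpha> :: real
  assumes \<alpha>_nonneg: "0 \<le> \<alpha>"
    and T_lipschitz: "tv_dist (T (x, u)) (T (x', u)) \<le> \<alpha> * dist x x'"
begin

abbreviation "\<delta> \<equiv> dobrushin borel (count_space UNIV) Q"

text \<open>Smoothing by the transition kernel: a function that is only bounded becomes Lipschitz after
integration against \<open>T (\<sqdot>, u)\<close>, which turns a Wasserstein distance before the transition into a
bound on merely measurable test functions after it.\<close>

lemma integral_T_diff_le_W1:
  assumes z: "z \<in> space (prob_algebra borel)" and z': "z' \<in> space (prob_algebra borel)"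
    and h[measurable]: "h \<in> borel_measurable borel" and osc: "\<And>x x'. h x - h x' \<le> L"
  shows "integral\<^sup>L (z \<bind> (\<lambda>x. T (x, u))) h - integral\<^sup>L (z' \<bind> (\<lambda>x. T (x, u))) h \<le> L * (\<alpha> / 2) * W1 z z'"
proof -
  obtain c where c: "\<And>x. 0 \<le> h x - c" "\<And>x. h x - c \<le> L"
    by (rule shift_into_interval[of h, OF osc]) blast
  define G where "G x = (\<integral>x'. h x' - c \<partial>T (x, u))" for x
  have L: "0 \<le> L" using c[of undefined] by linarith
  have eq: "integral\<^sup>L (w \<bind> (\<lambda>x. T (x, u))) h = integral\<^sup>L w G + c" if w: "w \<in> space (prob_algebra borel)" for w
  proof -
    have pw: "prob_space w" "sets w = sets borel" using w by (auto simp: space_prob_algebra)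
    note pw(2)[measurable_cong]
    have pb: "prob_space (w \<bind> (\<lambda>x. T (x, u)))" "sets (w \<bind> (\<lambda>x. T (x, u))) = sets borel"
      using bind_T_prob[OF w] by (auto simp: space_prob_algebra)
    interpret b: prob_space "w \<bind> (\<lambda>x. T (x, u))" by fact
    note pb(2)[measurable_cong]
    have "\<bar>h x\<bar> \<le> \<bar>c\<bar> + L" for x using c[of x] by linarith
    then have "integrable (w \<bind> (\<lambda>x. T (x, u))) h"
      by (intro integrable_bounded_prob[OF pb(1)]) auto
    then have "(\<integral>x. h x - c \<partial>(w \<bind> (\<lambda>x. T (x, u)))) = integral\<^sup>L (w \<bind> (\<lambda>x. T (x, u))) h - c"
      by (simp add: b.prob_space)
    moreover have "(\<integral>x. h x - c \<partial>(w \<bind> (\<lambda>x. T (x, u)))) = integral\<^sup>L w G"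
      unfolding G_def using pw c by (intro integral_bind_nonneg(1)[where N = borel and B = L]) auto
    ultimately show ?thesis by simp
  qed
  have "G x - G x' \<le> L * (\<alpha> / 2) * dist x x'" for x x'
  proof -
    have "G x - G x' \<le> L * (tv_dist (T (x, u)) (T (x', u)) / 2)"
      unfolding G_def using c by (intro integral_diff_le_tv prob_space_T sets_T) auto
    also have "\<dots> \<le> L * (\<alpha> * dist x x' / 2)"
      using L T_lipschitz[of x u x'] by (intro mult_left_mono divide_right_mono) auto
    finally show ?thesis by simp
  qed
  then have "integral\<^sup>L z G - integral\<^sup>L z' G \<le> L * (\<alpha> / 2) * W1 z z'"
    using z z' L \<alpha>_nonneg by (intro lipschitz_integral_diff_le_W1) (auto simp: space_prob_algebra)
  then show ?thesis using z z' by (simp add: eq)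
qed

text \<open>The telescoping through \<open>h1\<close> and \<open>h2\<close> described at the top, for arbitrary test functions.\<close>

lemma one_step_tests:
  fixes u :: 'u
  assumes z: "z \<in> space (prob_algebra borel)" and z': "z' \<in> space (prob_algebra borel)"
    and f: "\<And>y. f y \<in> lip1"
  defines "\<mu> \<equiv> z \<bind> (\<lambda>x. T (x, u))" and "\<nu> \<equiv> z' \<bind> (\<lambda>x. T (x, u))"
  shows "(\<Sum>y\<in>UNIV. measure (density \<mu> (lik y)) UNIV *
            (integral\<^sup>L (bayes_update Q \<rho> \<mu> y) (f y) - integral\<^sup>L (bayes_update Q \<rho> \<nu> y) (f y)))
         \<le> \<alpha> * (diameter (UNIV :: 'x set) / 2) * (2 - \<delta>) * W1 z z'"
proof -
  let ?D = "diameter (UNIV :: 'x set)"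
  have \<mu>: "\<mu> \<in> space (prob_algebra borel)" and \<nu>: "\<nu> \<in> space (prob_algebra borel)"
    unfolding \<mu>_def \<nu>_def by (intro bind_T_prob z z')+
  have "\<exists>c. (\<forall>x. 0 \<le> f y x - c) \<and> (\<forall>x. f y x - c \<le> ?D)" for y
    by (rule shift_into_interval[of "f y", OF lip1_osc[OF f]]) blast
  then obtain c where c: "\<And>y x. 0 \<le> f y x - c y" "\<And>y x. f y x - c y \<le> ?D" by metis
  define g where "g y x = f y x - c y" for y x
  have gm[measurable]: "g y \<in> borel_measurable borel" for y
    unfolding g_def using lip1_measurable[OF f] by measurable
  have g: "0 \<le> g y x" "g y x \<le> ?D" "\<bar>g y x\<bar> \<le> ?D" for y x using c[of y x] by (simp_all add: g_def)
  have fg: "integral\<^sup>L w (f y) = integral\<^sup>L w (g y) + c y" and gi: "integrable w (g y)"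
    and k: "0 \<le> integral\<^sup>L w (g y)" "integral\<^sup>L w (g y) \<le> ?D"
    if w: "w \<in> space (prob_algebra borel)" for w y
  proof -
    have pw: "prob_space w" "sets w = sets borel" using w by (auto simp: space_prob_algebra)
    interpret prob_space w by fact
    note pw(2)[measurable_cong]
    show gi: "integrable w (g y)" using g by (intro integrable_bounded_prob[OF pw(1)]) auto
    have "integrable w (f y)" by (intro lip1_integrable f pw)
    moreover have "g y = (\<lambda>x. f y x - c y)" by (rule ext) (simp add: g_def)
    ultimately show "integral\<^sup>L w (f y) = integral\<^sup>L w (g y) + c y" by (simp add: prob_space)
    show "0 \<le> integral\<^sup>L w (g y)" using g by simp
    have "integral\<^sup>L w (g y) \<le> (\<integral>x. ?D \<partial>w)" using g gi by (intro integral_mono) auto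
    then show "integral\<^sup>L w (g y) \<le> ?D" by (simp add: prob_space)
  qed
  define p where "p w y = measure (density w (lik y)) UNIV" for w y
  define k where "k y = integral\<^sup>L (bayes_update Q \<rho> \<nu> y) (g y)" for y
  have k: "0 \<le> k y" "k y \<le> ?D" for y using k[OF bayes_update_prob[OF \<nu>]] by (auto simp: k_def)
  define h1 where "h1 x = (\<Sum>y\<in>UNIV. lik y x * g y x)" for x
  define h2 where "h2 x = (\<Sum>y\<in>UNIV. lik y x * k y)" for x
  have h1: "integral\<^sup>L w h1 = (\<Sum>y\<in>UNIV. p w y * integral\<^sup>L (bayes_update Q \<rho> w y) (g y))"
    and h2: "integral\<^sup>L w h2 = (\<Sum>y\<in>UNIV. p w y * k y)"
    if w: "w \<in> space (prob_algebra borel)" for w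
  proof -
    have pw: "prob_space w" "sets w = sets borel" using w by (auto simp: space_prob_algebra)
    note pw(2)[measurable_cong]
    have "\<bar>lik y x * g y x\<bar> \<le> 1 * ?D" for y x
      unfolding abs_mult using g[of y x] lik_le_1[of x y] by (intro mult_mono) auto
    then have "integrable w (\<lambda>x. lik y x * g y x)" for y
      by (intro integrable_bounded_prob[OF pw(1)]) auto
    then have "integral\<^sup>L w h1 = (\<Sum>y\<in>UNIV. \<integral>x. lik y x * g y x \<partial>w)"
      unfolding h1_def by (intro Bochner_Integration.integral_sum)
    then show "integral\<^sup>L w h1 = (\<Sum>y\<in>UNIV. p w y * integral\<^sup>L (bayes_update Q \<rho> w y) (g y))"
      using integral_lik_mult[OF w gm g(1)] by (simp add: p_def)
    have lp: "integral\<^sup>L w (lik y) = p w y" for y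
      using integral_lik_mult[OF w, of "\<lambda>_. 1" y] bayes_update_prob[OF w, of y] prob_space.prob_space[of "bayes_update Q \<rho> w y"]
      by (simp add: p_def space_prob_algebra)
    have "integrable w (lik y)" for y
      using lik_le_1 by (intro integrable_bounded_prob[OF pw(1), of _ 1]) auto
    then have "integral\<^sup>L w h2 = (\<Sum>y\<in>UNIV. \<integral>x. lik y x * k y \<partial>w)"
      unfolding h2_def by (intro Bochner_Integration.integral_sum) auto
    then show "integral\<^sup>L w h2 = (\<Sum>y\<in>UNIV. p w y * k y)" by (simp add: lp)
  qed
  have m1: "h1 \<in> borel_measurable borel" and m2: "h2 \<in> borel_measurable borel"
    unfolding h1_def h2_def by measurable
  \<comment> \<open>A convex combination of functions with values in the interval from \<open>0\<close> to \<open>?D\<close>.\<close>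
  have osc1: "h1 x - h1 x' \<le> ?D" for x x'
  proof -
    have "h1 x \<le> (\<Sum>y\<in>UNIV. lik y x * ?D)" unfolding h1_def using g by (intro sum_mono mult_left_mono) auto
    also have "\<dots> = ?D" by (simp add: sum_lik_UNIV flip: sum_distrib_right)
    finally have "h1 x \<le> ?D" .
    moreover have "0 \<le> h1 x'" unfolding h1_def using g by (intro sum_nonneg mult_nonneg_nonneg) auto
    ultimately show ?thesis by linarith
  qed
  have osc2: "h2 x - h2 x' \<le> ?D * (1 - \<delta>)" for x x'
    unfolding h2_def using k by (rule mixture_osc_le)
  have "(\<Sum>y\<in>UNIV. p \<mu> y * (integral\<^sup>L (bayes_update Q \<rho> \<mu> y) (f y) - integral\<^sup>L (bayes_update Q \<rho> \<nu> y) (f y)))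
      = (\<Sum>y\<in>UNIV. p \<mu> y * (integral\<^sup>L (bayes_update Q \<rho> \<mu> y) (g y) - k y))"
    by (simp add: fg bayes_update_prob \<mu> \<nu> k_def)
  also have "\<dots> = integral\<^sup>L \<mu> h1 - integral\<^sup>L \<mu> h2"
    by (simp add: h1 h2 \<mu> right_diff_distrib sum_subtractf)
  \<comment> \<open>By the choice of \<open>k\<close>, the integrals of \<open>h1\<close> and \<open>h2\<close> against \<open>\<nu>\<close> agree.\<close>
  also have "\<dots> = (integral\<^sup>L \<mu> h1 - integral\<^sup>L \<nu> h1) + (integral\<^sup>L \<nu> h2 - integral\<^sup>L \<mu> h2)"
    by (simp add: h1 h2 \<nu> k_def)
  also have "\<dots> \<le> ?D * (\<alpha> / 2) * W1 z z' + ?D * (1 - \<delta>) * (\<alpha> / 2) * W1 z z'"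
  proof -
    have "integral\<^sup>L \<mu> h1 - integral\<^sup>L \<nu> h1 \<le> ?D * (\<alpha> / 2) * W1 z z'"
      unfolding \<mu>_def \<nu>_def by (intro integral_T_diff_le_W1 z z' m1 osc1)
    moreover have "integral\<^sup>L \<mu> (\<lambda>x. - h2 x) - integral\<^sup>L \<nu> (\<lambda>x. - h2 x) \<le> ?D * (1 - \<delta>) * (\<alpha> / 2) * W1 z z'"
      unfolding \<mu>_def \<nu>_def using osc2 m2 by (intro integral_T_diff_le_W1 z z') auto
    ultimately show ?thesis by simp
  qed
  also have "\<dots> = \<alpha> * (?D / 2) * (2 - \<delta>) * W1 z z'" by (simp add: field_simps)
  finally show ?thesis by (simp add: p_def)
qed

text \<open>The supremum in \<open>W1\<close> need not be attained a priori, so near-optimal test functions are used for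
each observation.\<close>

lemma one_step:
  fixes u :: 'u
  assumes z: "z \<in> space (prob_algebra borel)" and z': "z' \<in> space (prob_algebra borel)"
  defines "\<mu> \<equiv> z \<bind> (\<lambda>x. T (x, u))" and "\<nu> \<equiv> z' \<bind> (\<lambda>x. T (x, u))"
  shows "(\<Sum>y\<in>UNIV. measure (density \<mu> (lik y)) UNIV * W1 (bayes_update Q \<rho> \<mu> y) (bayes_update Q \<rho> \<nu> y))
         \<le> \<alpha> * (diameter (UNIV :: 'x set) / 2) * (2 - \<delta>) * W1 z z'" (is "_ \<le> ?R")
proof (rule field_le_epsilon)
  fix e :: real assume e: "0 < e"
  let ?p = "\<lambda>y. measure (density \<mu> (lik y)) UNIV"
  have \<mu>: "\<mu> \<in> space (prob_algebra borel)" unfolding \<mu>_def by (intro bind_T_prob z)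
  have sum1: "(\<Sum>y\<in>UNIV. ?p y) = 1"
  proof -
    have s: "sets \<mu> = sets borel" and "prob_space \<mu>" using \<mu> by (auto simp: space_prob_algebra)
    then have e1: "emeasure \<mu> UNIV = 1" using prob_space.emeasure_space_1[of \<mu>] sets_eq_imp_space_eq[OF s] by simp
    have "emeasure (density \<mu> (lik y)) UNIV \<le> 1" for y
      using emeasure_unfilt_le(1)[OF s, of "\<lambda>_. y" undefined 0] by (simp add: unfilt_def e1)
    then have "emeasure (density \<mu> (lik y)) UNIV \<noteq> top" for y
      by (metis ennreal_one_neq_top top_unique)
    then have "emeasure (density \<mu> (lik y)) UNIV = ennreal (?p y)" for y
      by (rule emeasure_eq_ennreal_measure)
    then have "(\<Sum>y\<in>UNIV. ennreal (?p y)) = 1"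
      using density_lik_sum[OF s, of UNIV] by (simp add: e1)
    then show ?thesis by (simp add: sum_ennreal)
  qed
  have "\<exists>f. f \<in> lip1 \<and> W1 (bayes_update Q \<rho> \<mu> y) (bayes_update Q \<rho> \<nu> y) - e
     \<le> integral\<^sup>L (bayes_update Q \<rho> \<mu> y) f - integral\<^sup>L (bayes_update Q \<rho> \<nu> y) f" for y
    by (rule W1_approx[OF e]) blast
  then obtain f where f: "\<And>y. f y \<in> lip1" "\<And>y. W1 (bayes_update Q \<rho> \<mu> y) (bayes_update Q \<rho> \<nu> y) - e
     \<le> integral\<^sup>L (bayes_update Q \<rho> \<mu> y) (f y) - integral\<^sup>L (bayes_update Q \<rho> \<nu> y) (f y)" by metis
  have "(\<Sum>y\<in>UNIV. ?p y * W1 (bayes_update Q \<rho> \<mu> y) (bayes_update Q \<rho> \<nu> y)) - e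
    = (\<Sum>y\<in>UNIV. ?p y * (W1 (bayes_update Q \<rho> \<mu> y) (bayes_update Q \<rho> \<nu> y) - e))"
    by (simp add: right_diff_distrib sum_subtractf sum1 flip: sum_distrib_right)
  also have "\<dots> \<le> (\<Sum>y\<in>UNIV. ?p y * (integral\<^sup>L (bayes_update Q \<rho> \<mu> y) (f y) - integral\<^sup>L (bayes_update Q \<rho> \<nu> y) (f y)))"
    using f by (intro sum_mono mult_left_mono) auto
  also have "\<dots> \<le> ?R" unfolding \<mu>_def \<nu>_def by (rule one_step_tests[OF z z' f(1)])
  finally show "(\<Sum>y\<in>UNIV. ?p y * W1 (bayes_update Q \<rho> \<mu> y) (bayes_update Q \<rho> \<nu> y)) \<le> ?R + e" by simp
qed

end

section \<open>Backward induction over observation and action words\<close>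

text \<open>The Bellman recursion for the terminal reward \<open>G\<close> with \<open>k\<close> steps to go. The probabilities of the
observations are part of \<open>G\<close>, so observations are simply summed over.\<close>

primrec opt_value :: "('y::finite list \<Rightarrow> 'u::finite list \<Rightarrow> real) \<Rightarrow> nat \<Rightarrow> 'y list \<Rightarrow> 'u list \<Rightarrow> real" where
  "opt_value G 0 ys us = G ys us"
| "opt_value G (Suc k) ys us = (MAX u. \<Sum>y\<in>UNIV. opt_value G k (ys @ [y]) (us @ [u]))"

definition action_value :: "('y::finite list \<Rightarrow> 'u::finite list \<Rightarrow> real) \<Rightarrow> nat \<Rightarrow> 'y list \<Rightarrow> 'u list \<Rightarrow> 'u \<Rightarrow> real" where
  "action_value G k ys us u = (\<Sum>y\<in>UNIV. opt_value G k (ys @ [y]) (us @ [u]))"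

lemma opt_value_Suc: "opt_value G (Suc k) ys us = (MAX u. action_value G k ys us u)"
  by (simp add: action_value_def)

lemma action_value_le_opt_value: "action_value G k ys us u \<le> opt_value G (Suc k) ys us"
  unfolding opt_value_Suc by (rule Max_ge) auto

text \<open>If two histories have proportional terminal rewards on all continuations, then they have
proportional values, with the same factor. This is what makes the window state sufficient.\<close>

lemma opt_value_scale:
  assumes "0 \<le> c"
    and "\<And>e e'. length e = k \<Longrightarrow> length e' = k \<Longrightarrow> G (ys @ e) (us @ e') = c * G' (ys' @ e) (us' @ e')"
  shows "opt_value G k ys us = c * opt_value G' k ys' us'"
  using assms(2)
proof (induction k arbitrary: ys us ys' us')
  case 0
  show ?case using 0[of "[]" "[]"] by simp
next
  case (Suc k)
  have "opt_value G k (ys @ [y]) (us @ [u]) = c * opt_value G' k (ys' @ [y]) (us' @ [u])" for y u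
  proof (rule Suc.IH)
    fix e :: "'a list" and e' :: "'b list" assume "length e = k" "length e' = k"
    then show "G ((ys @ [y]) @ e) ((us @ [u]) @ e') = c * G' ((ys' @ [y]) @ e) ((us' @ [u]) @ e')"
      using Suc.prems[of "y # e" "u # e'"] by simp
  qed
  then have "opt_value G (Suc k) ys us = (MAX u. c * action_value G' k ys' us' u)"
    by (simp add: action_value_def sum_distrib_left)
  also have "\<dots> = c * (MAX u. action_value G' k ys' us' u)"
    using mono_Max_commute[of "(*) c" "range (action_value G' k ys' us')"] assms(1)
    by (simp add: mono_def mult_left_mono image_image)
  finally show ?case by (simp only: opt_value_Suc)
qed

text \<open>When \<open>G\<close> contains the probabilities of the observations, this is the expectation of the reward at
time \<open>n\<close> under \<open>\<gamma>\<close>.\<close>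

definition policy_total :: "('y::finite list \<Rightarrow> 'u list \<Rightarrow> real) \<Rightarrow> ('y, 'u) policy \<Rightarrow> nat \<Rightarrow> real" where
  "policy_total G \<gamma> n = (\<Sum>ys | length ys = Suc n. G ys (actions \<gamma> ys n))"

lemma policy_total_Suc:
  "policy_total G \<gamma> (Suc n) = (\<Sum>ys | length ys = Suc n. \<Sum>y\<in>UNIV. G (ys @ [y]) (actions \<gamma> ys n @ [\<gamma> ys (actions \<gamma> ys n)]))"
  unfolding policy_total_def sum_lists_snoc[of _ "Suc n"] by (intro sum.cong refl) auto

lemma policy_total_opt_value_le:
  assumes "n \<le> H"
  shows "policy_total G \<gamma> H \<le> policy_total (opt_value G (H - n)) \<gamma> n"
  using assms
proof (induction n rule: inc_induct)
  case base
  then show ?case by (simp add: policy_total_def)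
next
  case (step n)
  then have "H - n = Suc (H - Suc n)" by simp
  have "policy_total (opt_value G (H - Suc n)) \<gamma> (Suc n) \<le> policy_total (opt_value G (H - n)) \<gamma> n"
    unfolding policy_total_Suc unfolding policy_total_def \<open>H - n = _\<close>
    using action_value_le_opt_value unfolding action_value_def by (intro sum_mono)
  with step.IH show ?case by simp
qed

lemma policy_total_opt_value_greedy:
  assumes "n \<le> H"
    and greedy: "\<And>ys us u. length us < H \<Longrightarrow> length ys = Suc (length us) \<Longrightarrow>
      action_value G (H - Suc (length us)) ys us u \<le> action_value G (H - Suc (length us)) ys us (\<gamma> ys us)"
  shows "policy_total G \<gamma> H = policy_total (opt_value G (H - n)) \<gamma> n"
  using assms(1)
proof (induction n rule: inc_induct)
  case base
  then show ?case by (simp add: policy_total_def)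
next
  case (step n)
  then have *: "H - n = Suc (H - Suc n)" by simp
  have "policy_total (opt_value G (H - Suc n)) \<gamma> (Suc n) = policy_total (opt_value G (H - n)) \<gamma> n"
    unfolding policy_total_Suc unfolding policy_total_def *
  proof (intro sum.cong refl)
    fix ys :: "'a list" assume "ys \<in> {ys. length ys = Suc n}"
    then have "action_value G (H - Suc n) ys (actions \<gamma> ys n) (\<gamma> ys (actions \<gamma> ys n)) = opt_value G (Suc (H - Suc n)) ys (actions \<gamma> ys n)"
      unfolding opt_value_Suc using greedy[of "actions \<gamma> ys n" ys] step.hyps by (intro Max_eqI[symmetric]) auto
    then show "(\<Sum>y\<in>UNIV. opt_value G (H - Suc n) (ys @ [y]) (actions \<gamma> ys n @ [\<gamma> ys (actions \<gamma> ys n)])) = opt_value G (Suc (H - Suc n)) ys (actions \<gamma> ys n)"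
      by (simp only: action_value_def)
  qed
  with step.IH show ?case by simp
qed

lemma policy_total_le_greedy:
  assumes "\<And>ys us u. length us < H \<Longrightarrow> length ys = Suc (length us) \<Longrightarrow>
      action_value G (H - Suc (length us)) ys us u \<le> action_value G (H - Suc (length us)) ys us (\<gamma>' ys us)"
  shows "policy_total G \<gamma> H \<le> policy_total G \<gamma>' H"
proof -
  have "policy_total G \<gamma> H \<le> policy_total (opt_value G H) \<gamma> 0" using policy_total_opt_value_le[of 0 H G \<gamma>] by simp
  also have "policy_total (opt_value G H) \<gamma> 0 = policy_total (opt_value G (H - 0)) \<gamma>' 0" by (simp add: policy_total_def)
  also have "\<dots> = policy_total G \<gamma>' H" by (rule policy_total_opt_value_greedy[OF le0 assms, symmetric])
  finally show ?thesis .
qed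

text \<open>Ties have to be broken by a fixed rule: the chosen action must depend on the function \<open>f\<close> alone.\<close>

definition arg_best :: "('u::finite \<Rightarrow> real) \<Rightarrow> 'u" where
  "arg_best f = (SOME u. \<forall>v. f v \<le> f u)"

lemma arg_best: "f v \<le> f (arg_best f)"
proof -
  have "Max (range f) \<in> range f" by (rule Max_in) auto
  then obtain u where "f u = Max (range f)" by (metis imageE)
  then have "\<forall>v. f v \<le> f u" by auto
  then have "\<forall>v. f v \<le> f (arg_best f)" unfolding arg_best_def by (rule someI)
  then show ?thesis ..
qed

section \<open>Measurable functions with prescribed values on a finite set\<close>

text \<open>Two distinct probability measures differ on some measurable set, so finitely many of them are
separated by the evaluations at finitely many sets.\<close>

lemma measurable_extension_prob_algebra:
  fixes f :: "'a measure \<Rightarrow> 'b"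
  assumes "finite R" "R \<subseteq> space (prob_algebra M)"
  shows "\<exists>g\<in>prob_algebra M \<rightarrow>\<^sub>M count_space UNIV. \<forall>\<mu>\<in>R. g \<mu> = f \<mu>"
  using assms
proof (induction R rule: finite_induct)
  case empty
  show ?case by (rule bexI[of _ "\<lambda>_. undefined"]) auto
next
  case (insert \<mu> R)
  then obtain g where g: "g \<in> prob_algebra M \<rightarrow>\<^sub>M count_space UNIV" "\<forall>\<nu>\<in>R. g \<nu> = f \<nu>" by auto
  have "\<exists>B\<in>sets M. measure \<nu> B \<noteq> measure \<mu> B" if \<nu>: "\<nu> \<in> R" for \<nu>
  proof (rule ccontr)
    assume neg: "\<not> ?thesis"
    have s: "sets \<nu> = sets M" "sets \<mu> = sets M" and p: "prob_space \<nu>" "prob_space \<mu>"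
      using insert.prems \<nu> by (auto simp: space_prob_algebra)
    interpret n: prob_space \<nu> by fact
    interpret m: prob_space \<mu> by fact
    have "\<nu> = \<mu>"
      by (rule measure_eqI) (use neg s in \<open>auto simp: n.emeasure_eq_measure m.emeasure_eq_measure\<close>)
    with \<nu> insert.hyps show False by simp
  qed
  then obtain B where B: "\<And>\<nu>. \<nu> \<in> R \<Longrightarrow> B \<nu> \<in> sets M" "\<And>\<nu>. \<nu> \<in> R \<Longrightarrow> measure \<nu> (B \<nu>) \<noteq> measure \<mu> (B \<nu>)"
    by metis
  \<comment> \<open>\<open>P\<close> holds for \<open>\<mu>\<close> and for no element of \<open>R\<close>.\<close>
  define P where "P \<nu> \<longleftrightarrow> (\<forall>\<kappa>\<in>R. measure \<nu> (B \<kappa>) = measure \<mu> (B \<kappa>))" for \<nu>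
  have P: "Measurable.pred (prob_algebra M) P"
    unfolding P_def using insert.hyps(1)
  proof (intro pred_intros_finite)
    fix \<kappa> assume "\<kappa> \<in> R"
    then have [measurable]: "B \<kappa> \<in> sets M" by (rule B)
    show "Measurable.pred (prob_algebra M) (\<lambda>\<nu>. measure \<nu> (B \<kappa>) = measure \<mu> (B \<kappa>))" by measurable
  qed
  show ?case
  proof (rule bexI[of _ "\<lambda>\<nu>. if P \<nu> then f \<mu> else g \<nu>"])
    show "\<forall>\<nu>\<in>insert \<mu> R. (if P \<nu> then f \<mu> else g \<nu>) = f \<nu>"
      using g(2) B(2) by (auto simp: P_def)
    show "(\<lambda>\<nu>. if P \<nu> then f \<mu> else g \<nu>) \<in> prob_algebra M \<rightarrow>\<^sub>M count_space UNIV"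
      using P g(1) by measurable
  qed
qed

lemma measurable_extension_window:
  fixes f :: "'a measure \<times> 'y::countable list \<times> 'u::countable list \<Rightarrow> 'b"
  assumes R: "finite R" and sub: "fst ` R \<subseteq> space (prob_algebra M)"
  shows "\<exists>g\<in>prob_algebra M \<Otimes>\<^sub>M (count_space UNIV \<Otimes>\<^sub>M count_space UNIV) \<rightarrow>\<^sub>M count_space UNIV.
           \<forall>w\<in>R. g w = f w"
proof -
  have "\<exists>g\<in>prob_algebra M \<rightarrow>\<^sub>M count_space UNIV. \<forall>\<mu>\<in>{\<mu>. (\<mu>, l) \<in> R}. g \<mu> = f (\<mu>, l)" for l
  proof (rule measurable_extension_prob_algebra)
    have "{\<mu>. (\<mu>, l) \<in> R} \<subseteq> fst ` R" by force
    then show "finite {\<mu>. (\<mu>, l) \<in> R}" "{\<mu>. (\<mu>, l) \<in> R} \<subseteq> space (prob_algebra M)"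
      using R sub by (auto intro: finite_subset)
  qed
  then obtain g where g: "\<And>l. g l \<in> prob_algebra M \<rightarrow>\<^sub>M count_space UNIV" "\<And>l \<mu>. (\<mu>, l) \<in> R \<Longrightarrow> g l \<mu> = f (\<mu>, l)"
    by (metis mem_Collect_eq)
  have "snd \<in> prob_algebra M \<Otimes>\<^sub>M (count_space UNIV \<Otimes>\<^sub>M count_space UNIV) \<rightarrow>\<^sub>M
      (count_space UNIV \<Otimes>\<^sub>M count_space UNIV :: ('y list \<times> 'u list) measure)"
    by measurable
  then have "snd \<in> prob_algebra M \<Otimes>\<^sub>M (count_space UNIV \<Otimes>\<^sub>M count_space UNIV) \<rightarrow>\<^sub>M
      (count_space UNIV :: ('y list \<times> 'u list) measure)"
    by (simp add: pair_measure_countable)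
  then have "(\<lambda>w. g (snd w) (fst w)) \<in> prob_algebra M \<Otimes>\<^sub>M (count_space UNIV \<Otimes>\<^sub>M count_space UNIV) \<rightarrow>\<^sub>M count_space UNIV"
    by (rule measurable_compose_countable'[rotated]) (auto intro: measurable_compose[OF _ g(1)])
  then show ?thesis using g(2) by (intro bexI[of _ "\<lambda>w. g (snd w) (fst w)"]) auto
qed

section \<open>Window policies attain the optimum over all policies\<close>

context pomdp
begin

text \<open>The integrand in the definition of \<open>Lbar\<close>.\<close>

definition post_dist :: "'x measure \<Rightarrow> 'x measure \<Rightarrow> nat \<Rightarrow> nat \<Rightarrow> 'y list \<Rightarrow> 'u list \<Rightarrow> real" where
  "post_dist zs z t M ys us =
     W1 (posterior T Q \<rho> (predictor T Q \<rho> z (take t ys) (take t us)) (\<lambda>j. ys ! (t + j)) (\<lambda>j. us ! (t + j)) M)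
        (posterior T Q \<rho> zs (\<lambda>j. ys ! (t + j)) (\<lambda>j. us ! (t + j)) M)"

text \<open>The integrand multiplied by the probability of the observations when the actions \<open>us\<close> are played:
the terminal reward of the finite-horizon problem.\<close>

definition weighted_dist :: "'x measure \<Rightarrow> 'x measure \<Rightarrow> nat \<Rightarrow> nat \<Rightarrow> 'y list \<Rightarrow> 'u list \<Rightarrow> real" where
  "weighted_dist zs z t M ys us = measure (unfilt z ((!) ys) ((!) us) (t + M)) UNIV * post_dist zs z t M ys us"

lemma unfilt_finite: "z \<in> space (prob_algebra borel) \<Longrightarrow> emeasure (unfilt z y u n) UNIV \<noteq> top"
  and unpred_finite: "z \<in> space (prob_algebra borel) \<Longrightarrow> emeasure (unpred z y u n) UNIV \<noteq> top"
proof -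
  assume z: "z \<in> space (prob_algebra borel)"
  then have s: "sets z = sets borel" and "prob_space z" by (auto simp: space_prob_algebra)
  then have "emeasure z UNIV = 1" using prob_space.emeasure_space_1[of z] sets_eq_imp_space_eq[OF s] by simp
  then show "emeasure (unfilt z y u n) UNIV \<noteq> top" "emeasure (unpred z y u n) UNIV \<noteq> top"
    using emeasure_unfilt_le[OF s, of y u n] by (metis ennreal_one_neq_top top_unique)+
qed

text \<open>The unnormalized recursions can be restarted at time \<open>s\<close> from the normalized predictor; the factor
is the probability of the history up to \<open>s\<close>.\<close>

lemma unpred_split:
  assumes z: "z \<in> space (prob_algebra borel)" and l: "s \<le> length ys" "s \<le> length us"
  shows "unpred z ((!) ys) ((!) us) (s + n) =
     scale_measure (emeasure (unpred z ((!) ys) ((!) us) s) UNIV)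
       (unpred (predictor T Q \<rho> z (take s ys) (take s us)) ((!) (drop s ys)) ((!) (drop s us)) n)"
    and "unfilt z ((!) ys) ((!) us) (s + n) =
     scale_measure (emeasure (unpred z ((!) ys) ((!) us) s) UNIV)
       (unfilt (predictor T Q \<rho> z (take s ys) (take s us)) ((!) (drop s ys)) ((!) (drop s us)) n)"
proof -
  let ?\<mu> = "predictor T Q \<rho> z (take s ys) (take s us)"
  have \<mu>: "sets ?\<mu> = sets borel" using predictor_prob[OF z] by (simp add: space_prob_algebra)
  have "unpred z ((!) ys) ((!) us) s = unpred z ((!) (take s ys)) ((!) (take s us)) s"
    by (rule unpred_cong) auto
  moreover have "unpred z ((!) (take s ys)) ((!) (take s us)) s =
      scale_measure (emeasure (unpred z ((!) (take s ys)) ((!) (take s us)) s) UNIV) ?\<mu>"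
    using unpred_eq_predictor[OF z, of "take s ys" "take s us"] l by simp
  ultimately have *: "unpred z ((!) ys) ((!) us) s = scale_measure (emeasure (unpred z ((!) ys) ((!) us) s) UNIV) ?\<mu>"
    by simp
  have d: "(\<lambda>j. ys ! (s + j)) = (!) (drop s ys)" "(\<lambda>j. us ! (s + j)) = (!) (drop s us)"
    using l by (auto intro!: ext)
  show "unpred z ((!) ys) ((!) us) (s + n) =
     scale_measure (emeasure (unpred z ((!) ys) ((!) us) s) UNIV) (unpred ?\<mu> ((!) (drop s ys)) ((!) (drop s us)) n)"
    unfolding unpred_add by (subst *) (simp add: unpred_scale \<mu> d)
  show "unfilt z ((!) ys) ((!) us) (s + n) =
     scale_measure (emeasure (unpred z ((!) ys) ((!) us) s) UNIV) (unfilt ?\<mu> ((!) (drop s ys)) ((!) (drop s us)) n)"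
    unfolding unfilt_add by (subst *) (simp add: unfilt_scale \<mu> d)
qed

text \<open>A predictor can be computed from an earlier one and the observations and actions in between. This
fails for histories of probability \<open>0\<close>: there the left side is the fallback measure, whereas the
right side need not be.\<close>

lemma predictor_split:
  assumes z: "z \<in> space (prob_algebra borel)" and l: "s + n \<le> length ys" "s + n \<le> length us"
    and pos: "emeasure (unpred z ((!) ys) ((!) us) (s + n)) UNIV \<noteq> 0"
  shows "predictor T Q \<rho> z (take (s + n) ys) (take (s + n) us) =
     predictor T Q \<rho> (predictor T Q \<rho> z (take s ys) (take s us)) (take n (drop s ys)) (take n (drop s us))"
proof -
  let ?\<mu> = "predictor T Q \<rho> z (take s ys) (take s us)"
  let ?\<nu> = "predictor T Q \<rho> ?\<mu> (take n (drop s ys)) (take n (drop s us))"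
  let ?a = "emeasure (unpred z ((!) ys) ((!) us) (s + n)) UNIV"
  have \<mu>: "?\<mu> \<in> space (prob_algebra borel)" by (rule predictor_prob[OF z])
  have \<nu>: "?\<nu> \<in> space (prob_algebra borel)" by (rule predictor_prob[OF \<mu>])
  obtain r where r: "unpred z ((!) ys) ((!) us) (s + n) = scale_measure r ?\<nu>"
  proof
    have "unpred ?\<mu> ((!) (drop s ys)) ((!) (drop s us)) n = unpred ?\<mu> ((!) (take n (drop s ys))) ((!) (take n (drop s us))) n"
      by (rule unpred_cong) auto
    then have "unpred ?\<mu> ((!) (drop s ys)) ((!) (drop s us)) n =
      scale_measure (emeasure (unpred ?\<mu> ((!) (drop s ys)) ((!) (drop s us)) n) UNIV) ?\<nu>"
      using unpred_eq_predictor[OF \<mu>, of "take n (drop s ys)" "take n (drop s us)"] l by simp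
    then show "unpred z ((!) ys) ((!) us) (s + n) = scale_measure (emeasure (unpred z ((!) ys) ((!) us) s) UNIV *
        emeasure (unpred ?\<mu> ((!) (drop s ys)) ((!) (drop s us)) n) UNIV) ?\<nu>"
      using unpred_split(1)[OF z, of s ys us n] l by (metis add_leD1 scale_scale_measure)
  qed
  have s\<nu>: "sets ?\<nu> = sets borel" and "prob_space ?\<nu>" using \<nu> by (auto simp: space_prob_algebra)
  then have "emeasure ?\<nu> UNIV = 1" using prob_space.emeasure_space_1[of ?\<nu>] sets_eq_imp_space_eq[OF s\<nu>] by simp
  with r have "r = ?a" by simp
  have A: "unpred z ((!) ys) ((!) us) (s + n) = scale_measure ?a (predictor T Q \<rho> z (take (s + n) ys) (take (s + n) us))"
    using unpred_split(1)[OF z l, of 0] by (simp only: add_0_right unpred.simps(1))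
  from A r have "scale_measure ?a (predictor T Q \<rho> z (take (s + n) ys) (take (s + n) us)) = scale_measure ?a ?\<nu>"
    unfolding \<open>r = ?a\<close> by (rule trans[OF sym])
  then show ?thesis using pos unpred_finite[OF z] by (rule scale_measure_cancel)
qed

text \<open>The terminal reward depends on the history before \<open>s \<le> t\<close> only through the predictor at time \<open>s\<close>
and a common factor; a history of probability \<open>0\<close>, where the predictors may disagree, contributes
\<open>0\<close> on both sides.\<close>

lemma weighted_dist_split:
  assumes z: "z \<in> space (prob_algebra borel)" and st: "s \<le> t"
    and l: "length ys = Suc (t + M)" "length us = t + M"
  shows "weighted_dist zs z t M ys us = measure (unpred z ((!) ys) ((!) us) s) UNIV *
     weighted_dist zs (predictor T Q \<rho> z (take s ys) (take s us)) (t - s) M (drop s ys) (drop s us)"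
proof -
  let ?\<mu> = "predictor T Q \<rho> z (take s ys) (take s us)"
  let ?c = "measure (unpred z ((!) ys) ((!) us) s) UNIV"
  have e: "s + (t - s + M) = t + M" "s + (t - s) = t" using st by auto
  have m: "measure (unfilt z ((!) ys) ((!) us) (t + M)) UNIV =
      ?c * measure (unfilt ?\<mu> ((!) (drop s ys)) ((!) (drop s us)) (t - s + M)) UNIV"
    using unpred_split(2)[OF z, of s ys us "t - s + M"] l st unfolding e
    by (simp add: measure_def enn2real_mult)
  show ?thesis
  proof (cases "measure (unfilt z ((!) ys) ((!) us) (t + M)) UNIV = 0")
    case True
    then show ?thesis using m by (auto simp: weighted_dist_def)
  next
    case False
    have "emeasure (unpred z ((!) ys) ((!) us) t) UNIV \<noteq> 0"
      using False unpred_split(2)[OF z, of t ys us M] l by (auto simp: measure_def)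
    then have "predictor T Q \<rho> z (take t ys) (take t us) = predictor T Q \<rho> ?\<mu> (take (t - s) (drop s ys)) (take (t - s) (drop s us))"
      using predictor_split[OF z, of s "t - s" ys us] l st by simp
    then have "post_dist zs z t M ys us = post_dist zs ?\<mu> (t - s) M (drop s ys) (drop s us)"
      using l st by (simp add: post_dist_def)
    then show ?thesis by (simp add: weighted_dist_def m)
  qed
qed

lemma action_value_split:
  assumes z: "z \<in> space (prob_algebra borel)" and st: "s \<le> t" "s \<le> n" and n: "n < t + M"
    and l: "length ys = Suc n" "length us = n"
  shows "action_value (weighted_dist zs z t M) (t + M - Suc n) ys us u = measure (unpred z ((!) ys) ((!) us) s) UNIV *
     action_value (weighted_dist zs (predictor T Q \<rho> z (take s ys) (take s us)) (t - s) M) (t + M - Suc n) (drop s ys) (drop s us) u"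
proof -
  let ?\<mu> = "predictor T Q \<rho> z (take s ys) (take s us)"
  let ?c = "measure (unpred z ((!) ys) ((!) us) s) UNIV"
  have "opt_value (weighted_dist zs z t M) (t + M - Suc n) (ys @ [y]) (us @ [u]) =
      ?c * opt_value (weighted_dist zs ?\<mu> (t - s) M) (t + M - Suc n) (drop s ys @ [y]) (drop s us @ [u])" for y
  proof (rule opt_value_scale)
    fix e :: "'y list" and e' :: "'u list" assume e: "length e = t + M - Suc n" "length e' = t + M - Suc n"
    have "unpred z ((!) ((ys @ [y]) @ e)) ((!) ((us @ [u]) @ e')) s = unpred z ((!) ys) ((!) us) s"
      using l st by (intro unpred_cong) (auto simp: nth_append)
    then show "weighted_dist zs z t M ((ys @ [y]) @ e) ((us @ [u]) @ e') =
        ?c * weighted_dist zs ?\<mu> (t - s) M ((drop s ys @ [y]) @ e) ((drop s us @ [u]) @ e')"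
      using weighted_dist_split[OF z st(1), of "(ys @ [y]) @ e" M "(us @ [u]) @ e'" zs] e l n st by simp
  qed simp
  then show ?thesis by (simp add: action_value_def sum_distrib_left)
qed

text \<open>A maximizer of the action value is unaffected by the nonnegative factor of \<open>action_value_split\<close>, so
it can be computed from the window state. The window starts at \<open>n - M\<close>, which is smaller than \<open>t\<close>
exactly as long as \<open>n < t + M\<close>, that is, up to the last action that matters. Measurability in the
window state is no restriction since only finitely many window states occur at each time.\<close>

lemma greedy_window_policy:
  assumes z: "z \<in> space (prob_algebra borel)"
  obtains \<gamma> where "\<gamma> \<in> window_policies T Q \<rho> z M"
    "\<And>ys us u. length us < t + M \<Longrightarrow> length ys = Suc (length us) \<Longrightarrow>
      action_value (weighted_dist zs z t M) (t + M - Suc (length us)) ys us u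
        \<le> action_value (weighted_dist zs z t M) (t + M - Suc (length us)) ys us (\<gamma> ys us)"
proof -
  \<comment> \<open>The greedy action for the problem restarted at the beginning \<open>n - M\<close> of the window.\<close>
  define a where "a n = (\<lambda>(\<mu>, wy, wu). arg_best (action_value (weighted_dist zs \<mu> (t - (n - M)) M) (t + M - Suc n) wy wu))" for n
  define R where "R n = {window T Q \<rho> z M ys us | ys us. length ys = Suc n \<and> length us = n}" for n
  have "\<exists>g\<in>prob_algebra borel \<Otimes>\<^sub>M (count_space UNIV \<Otimes>\<^sub>M count_space UNIV) \<rightarrow>\<^sub>M count_space UNIV. \<forall>w\<in>R n. g w = a n w" for n
  proof (rule measurable_extension_window)
    have "R n = (\<lambda>(ys, us). window T Q \<rho> z M ys us) ` ({ys. length ys = Suc n} \<times> {us. length us = n})"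
      by (auto simp: R_def)
    moreover have "finite {ys :: 'y list. length ys = Suc n}" "finite {us :: 'u list. length us = n}"
      using finite_lists_length_eq[of "UNIV :: 'y set" "Suc n"] finite_lists_length_eq[of "UNIV :: 'u set" n] by simp_all
    ultimately show "finite (R n)" by simp
    show "fst ` R n \<subseteq> space (prob_algebra borel)"
      using predictor_prob[OF z] by (auto simp: R_def window_def Let_def)
  qed
  then obtain g where g: "\<And>n. g n \<in> prob_algebra borel \<Otimes>\<^sub>M (count_space UNIV \<Otimes>\<^sub>M count_space UNIV) \<rightarrow>\<^sub>M count_space UNIV"
      "\<And>n w. w \<in> R n \<Longrightarrow> g n w = a n w" by metis
  \<comment> \<open>Before time \<open>M\<close> a window policy may use the whole history.\<close>
  define \<gamma> where "\<gamma> ys us = (if length us < M then arg_best (action_value (weighted_dist zs z t M) (t + M - Suc (length us)) ys us)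
       else g (length us) (window T Q \<rho> z M ys us))" for ys us
  show ?thesis
  proof
    show "\<gamma> \<in> window_policies T Q \<rho> z M"
      unfolding window_policies_def by (auto intro!: exI[of _ g] simp: g(1) \<gamma>_def)
    fix ys :: "'y list" and us :: "'u list" and u :: 'u assume l: "length us < t + M" "length ys = Suc (length us)"
    let ?n = "length us" let ?s = "length us - M"
    show "action_value (weighted_dist zs z t M) (t + M - Suc ?n) ys us u \<le> action_value (weighted_dist zs z t M) (t + M - Suc ?n) ys us (\<gamma> ys us)"
    proof (cases "?n < M")
      case True
      then show ?thesis by (simp add: \<gamma>_def arg_best)
    next
      case False
      let ?\<mu> = "predictor T Q \<rho> z (take ?s ys) (take ?s us)"
      have "\<gamma> ys us = a ?n (window T Q \<rho> z M ys us)"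
        using False g(2)[of "window T Q \<rho> z M ys us" ?n] l by (auto simp: \<gamma>_def R_def)
      also have "\<dots> = arg_best (action_value (weighted_dist zs ?\<mu> (t - ?s) M) (t + M - Suc ?n) (drop ?s ys) (drop ?s us))"
        by (simp add: a_def window_def Let_def)
      finally have \<gamma>: "\<gamma> ys us = \<dots>" .
      have s: "?s \<le> t" "?s \<le> ?n" using l by auto
      show ?thesis
        unfolding action_value_split[OF z s l(1) l(2) refl] \<gamma> by (intro mult_left_mono arg_best) simp
    qed
  qed
qed

lemma integral_joint_law:
  assumes z: "z \<in> space (prob_algebra borel)" and F: "\<And>ys us. 0 \<le> F ys us"
  shows "(\<integral>(x, ys, us). F ys us \<partial>joint_law T Q z \<gamma> n) =
     policy_total (\<lambda>ys us. measure (unfilt z ((!) ys) ((!) us) n) UNIV * F ys us) \<gamma> n"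
proof -
  have sz: "sets z = sets borel" using z by (simp add: space_prob_algebra)
  note sets_joint_law[OF z, of \<gamma> n, measurable_cong]
  have "(\<lambda>h. F (fst (snd h)) (snd (snd h))) \<in> (hist_algebra :: ('x \<times> 'y list \<times> 'u list) measure) \<rightarrow>\<^sub>M count_space UNIV"
    by (intro measurable_discrete2[where h=F]) measurable
  from measurable_compose[OF this, of "\<lambda>r. r" borel]
  have m: "(\<lambda>h. F (fst (snd h)) (snd (snd h))) \<in> borel_measurable (hist_algebra :: ('x \<times> 'y list \<times> 'u list) measure)"
    by simp
  have "(\<integral>(x, ys, us). F ys us \<partial>joint_law T Q z \<gamma> n) = enn2real (\<integral>\<^sup>+h. ennreal (F (fst (snd h)) (snd (snd h))) \<partial>joint_law T Q z \<gamma> n)"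
    unfolding split_beta using m F by (intro integral_eq_nn_integral) (auto cong: measurable_cong_sets)
  also have "(\<integral>\<^sup>+h. ennreal (F (fst (snd h)) (snd (snd h))) \<partial>joint_law T Q z \<gamma> n) =
      (\<Sum>ys | length ys = Suc n. \<integral>\<^sup>+x. ennreal (F ys (actions \<gamma> ys n)) \<partial>unfilt z ((!) ys) ((!) (actions \<gamma> ys n)) n)"
    using m by (subst nn_integral_joint_law[OF z]) auto
  also have "\<dots> = (\<Sum>ys | length ys = Suc n. ennreal (measure (unfilt z ((!) ys) ((!) (actions \<gamma> ys n)) n) UNIV * F ys (actions \<gamma> ys n)))"
  proof (intro sum.cong refl)
    fix ys :: "'y list"
    let ?m = "unfilt z ((!) ys) ((!) (actions \<gamma> ys n)) n"
    have "space ?m = UNIV" using sets_eq_imp_space_eq[OF sets_unfilt[OF sz]] by simp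
    moreover have "emeasure ?m UNIV = ennreal (measure ?m UNIV)"
      by (rule emeasure_eq_ennreal_measure[OF unfilt_finite[OF z]])
    ultimately show "(\<integral>\<^sup>+x. ennreal (F ys (actions \<gamma> ys n)) \<partial>?m) = ennreal (measure ?m UNIV * F ys (actions \<gamma> ys n))"
      using F by (simp add: ennreal_mult mult.commute)
  qed
  also have "enn2real \<dots> = policy_total (\<lambda>ys us. measure (unfilt z ((!) ys) ((!) us) n) UNIV * F ys us) \<gamma> n"
    unfolding policy_total_def using F by (subst sum_ennreal) (auto intro!: enn2real_ennreal sum_nonneg)
  finally show ?thesis .
qed

end

context regular_pomdp
begin

lemma post_dist_nonneg:
  assumes z: "z \<in> space (prob_algebra borel)" and zs: "zs \<in> space (prob_algebra borel)"
  shows "0 \<le> post_dist zs z t M ys us"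
proof -
  note p = posterior_prob[OF predictor_prob[OF z]] and ps = posterior_prob[OF zs]
  show ?thesis
    unfolding post_dist_def
    by (rule W1_nonneg[OF prob_space_if_prob_algebra[OF p] sets_if_prob_algebra[OF p]
          prob_space_if_prob_algebra[OF ps] sets_if_prob_algebra[OF ps]])
qed

lemma post_dist_le:
  assumes z: "z \<in> space (prob_algebra borel)" and zs: "zs \<in> space (prob_algebra borel)"
  shows "post_dist zs z t M ys us \<le> diameter (UNIV :: 'x set)"
proof -
  note p = posterior_prob[OF predictor_prob[OF z]] and ps = posterior_prob[OF zs]
  show ?thesis
    unfolding post_dist_def
    by (rule W1_le_diameter[OF prob_space_if_prob_algebra[OF p] sets_if_prob_algebra[OF p]
          prob_space_if_prob_algebra[OF ps] sets_if_prob_algebra[OF ps]])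
qed

lemma Lbar_eq:
  assumes z: "z \<in> space (prob_algebra borel)" and zs: "zs \<in> space (prob_algebra borel)"
  shows "Lbar T Q \<rho> z zs t M = (SUP \<gamma>\<in>window_policies T Q \<rho> z M. policy_total (weighted_dist zs z t M) \<gamma> (t + M))"
proof -
  have "(\<integral>(x, ys, us). W1 (posterior T Q \<rho> (predictor T Q \<rho> z (take t ys) (take t us)) (\<lambda>j. ys ! (t + j)) (\<lambda>j. us ! (t + j)) M)
        (posterior T Q \<rho> zs (\<lambda>j. ys ! (t + j)) (\<lambda>j. us ! (t + j)) M) \<partial>joint_law T Q z \<gamma> (t + M))
     = policy_total (weighted_dist zs z t M) \<gamma> (t + M)" for \<gamma>
    using integral_joint_law[OF z, of "post_dist zs z t M" \<gamma> "t + M"] post_dist_nonneg[OF z zs]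
    by (simp add: weighted_dist_def[abs_def] post_dist_def)
  then show ?thesis by (simp add: Lbar_def)
qed

lemma policy_total_bdd_above:
  assumes z: "z \<in> space (prob_algebra borel)" and zs: "zs \<in> space (prob_algebra borel)"
  shows "bdd_above ((\<lambda>\<gamma>. policy_total (weighted_dist zs z t M) \<gamma> (t + M)) ` S)"
proof (rule bdd_aboveI2)
  fix \<gamma>
  have "measure (unfilt z y u n) UNIV \<le> 1" for y u n
  proof -
    have s: "sets z = sets borel" and "prob_space z" using z by (auto simp: space_prob_algebra)
    then have "emeasure z UNIV = 1" using prob_space.emeasure_space_1[of z] sets_eq_imp_space_eq[OF s] by simp
    then show ?thesis
      using emeasure_unfilt_le(1)[OF s, of y u n] unfilt_finite[OF z, of y u n]
      by (simp add: emeasure_eq_ennreal_measure)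
  qed
  then have "weighted_dist zs z t M ys us \<le> 1 * diameter (UNIV :: 'x set)" for ys us
    unfolding weighted_dist_def using post_dist_le[OF z zs] post_dist_nonneg[OF z zs] by (intro mult_mono) auto
  then show "policy_total (weighted_dist zs z t M) \<gamma> (t + M) \<le> (\<Sum>ys :: 'y list | length ys = Suc (t + M). diameter (UNIV :: 'x set))"
    unfolding policy_total_def by (intro sum_mono) simp
qed

text \<open>The supremum over window policies dominates every history-dependent policy, in particular those
that look back one step further.\<close>

lemma policy_total_le_Lbar:
  assumes z: "z \<in> space (prob_algebra borel)" and zs: "zs \<in> space (prob_algebra borel)"
  shows "policy_total (weighted_dist zs z t M) \<gamma> (t + M) \<le> Lbar T Q \<rho> z zs t M"
proof -
  obtain \<gamma>' where \<gamma>': "\<gamma>' \<in> window_policies T Q \<rho> z M"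
    "\<And>ys us u. length us < t + M \<Longrightarrow> length ys = Suc (length us) \<Longrightarrow>
      action_value (weighted_dist zs z t M) (t + M - Suc (length us)) ys us u
        \<le> action_value (weighted_dist zs z t M) (t + M - Suc (length us)) ys us (\<gamma>' ys us)"
    by (rule greedy_window_policy[OF z]) blast
  have "policy_total (weighted_dist zs z t M) \<gamma> (t + M) \<le> policy_total (weighted_dist zs z t M) \<gamma>' (t + M)"
    by (rule policy_total_le_greedy[OF \<gamma>'(2)])
  also have "\<dots> \<le> Lbar T Q \<rho> z zs t M"
    unfolding Lbar_eq[OF z zs] by (rule cSUP_upper[OF \<gamma>'(1) policy_total_bdd_above[OF z zs]])
  finally show ?thesis .
qed

section \<open>Contraction of the expected posterior distance\<close>

text \<open>The contraction \<open>one_step\<close> applied along a history, whose probability is a common factor. It needs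
the first posterior to be the conditional law of the state given the whole history; this is the
role of \<open>unpred_split\<close> and \<open>unfilt_eq_posterior\<close>.\<close>

lemma weighted_dist_step:
  assumes z: "z \<in> space (prob_algebra borel)" and zs: "zs \<in> space (prob_algebra borel)"
    and l: "length ys = Suc (t + M)" "length us = t + M"
  shows "(\<Sum>y\<in>UNIV. weighted_dist zs z t (Suc M) (ys @ [y]) (us @ [u]))
     \<le> \<alpha> * (diameter (UNIV :: 'x set) / 2) * (2 - \<delta>) * weighted_dist zs z t M ys us"
proof -
  let ?z = "predictor T Q \<rho> z (take t ys) (take t us)"
  let ?y = "\<lambda>j. ys ! (t + j)" and ?u = "\<lambda>j. us ! (t + j)"
  let ?p = "posterior T Q \<rho> ?z ?y ?u M" and ?p' = "posterior T Q \<rho> zs ?y ?u M"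
  let ?m = "unfilt z ((!) ys) ((!) us) (t + M)"
  let ?\<mu> = "?p \<bind> (\<lambda>x. T (x, u))" and ?\<nu> = "?p' \<bind> (\<lambda>x. T (x, u))"
  have pz: "?z \<in> space (prob_algebra borel)" by (rule predictor_prob[OF z])
  have p: "?p \<in> space (prob_algebra borel)" and p': "?p' \<in> space (prob_algebra borel)"
    by (rule posterior_prob[OF pz], rule posterior_prob[OF zs])
  have sp: "sets ?p = sets borel" and "prob_space ?p" using p by (auto simp: space_prob_algebra)
  then have p1: "emeasure ?p UNIV = 1" using prob_space.emeasure_space_1[of ?p] sets_eq_imp_space_eq[OF sp] by simp
  have d: "?y = (!) (drop t ys)" "?u = (!) (drop t us)" using l by (auto intro!: ext)
  obtain r where "?m = scale_measure r ?p"
    using unpred_split(2)[OF z, of t ys us M] unfilt_eq_posterior[OF pz, of ?y ?u M] l unfolding d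
    by (metis le_add1 le_SucI scale_scale_measure)
  then have m: "?m = scale_measure (emeasure ?m UNIV) ?p" using p1 by simp
  have step: "weighted_dist zs z t (Suc M) (ys @ [y]) (us @ [u]) =
     measure ?m UNIV * (measure (density ?\<mu> (lik y)) UNIV * W1 (bayes_update Q \<rho> ?\<mu> y) (bayes_update Q \<rho> ?\<nu> y))" for y
  proof -
    have "unfilt z ((!) (ys @ [y])) ((!) (us @ [u])) (t + M) = ?m"
      using l by (intro unfilt_cong) (auto simp: nth_append)
    then have "unfilt z ((!) (ys @ [y])) ((!) (us @ [u])) (t + Suc M) = density (?m \<bind> (\<lambda>x. T (x, u))) (lik y)"
      using l by (simp add: unfilt_def[of _ _ _ "Suc (t + M)"] unpred_Suc nth_append del: unpred.simps(2))
    also have "\<dots> = scale_measure (emeasure ?m UNIV) (density ?\<mu> (lik y))"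
      by (subst m) (simp add: bind_T_scale density_lik_scale sp)
    finally have 1: "measure (unfilt z ((!) (ys @ [y])) ((!) (us @ [u])) (t + Suc M)) UNIV =
       measure ?m UNIV * measure (density ?\<mu> (lik y)) UNIV"
      by (simp add: measure_def enn2real_mult)
    have "posterior T Q \<rho> w (\<lambda>j. (ys @ [y]) ! (t + j)) (\<lambda>j. (us @ [u]) ! (t + j)) M = posterior T Q \<rho> w ?y ?u M" for w
      using l by (intro posterior_cong) (auto simp: nth_append)
    then have "post_dist zs z t (Suc M) (ys @ [y]) (us @ [u]) = W1 (bayes_update Q \<rho> ?\<mu> y) (bayes_update Q \<rho> ?\<nu> y)"
      using l by (simp add: post_dist_def nth_append)
    with 1 show ?thesis by (simp add: weighted_dist_def mult.assoc)
  qed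
  have "(\<Sum>y\<in>UNIV. weighted_dist zs z t (Suc M) (ys @ [y]) (us @ [u])) = measure ?m UNIV *
     (\<Sum>y\<in>UNIV. measure (density ?\<mu> (lik y)) UNIV * W1 (bayes_update Q \<rho> ?\<mu> y) (bayes_update Q \<rho> ?\<nu> y))"
    unfolding step by (simp add: sum_distrib_left)
  also have "\<dots> \<le> measure ?m UNIV * (\<alpha> * (diameter (UNIV :: 'x set) / 2) * (2 - \<delta>) * W1 ?p ?p')"
    by (intro mult_left_mono one_step p p') simp
  also have "\<dots> = \<alpha> * (diameter (UNIV :: 'x set) / 2) * (2 - \<delta>) * weighted_dist zs z t M ys us"
    by (simp add: weighted_dist_def post_dist_def)
  finally show ?thesis .
qed

lemma Lbar_step:
  assumes z: "z \<in> space (prob_algebra borel)" and zs: "zs \<in> space (prob_algebra borel)"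
  shows "Lbar T Q \<rho> z zs t (Suc M)
     \<le> \<alpha> * (diameter (UNIV :: 'x set) / 2) * (2 - \<delta>) * Lbar T Q \<rho> z zs t M"
proof -
  let ?C = "\<alpha> * (diameter (UNIV :: 'x set) / 2) * (2 - \<delta>)"
  have C: "0 \<le> ?C" using \<alpha>_nonneg diameter_UNIV_nonneg dobrushin_le_1 by simp
  have ne: "window_policies T Q \<rho> z (Suc M) \<noteq> {}"
  proof -
    have "(\<lambda>_ _. undefined) \<in> window_policies T Q \<rho> z (Suc M)"
      unfolding window_policies_def by (auto intro!: exI[of _ "\<lambda>_ _. undefined"])
    then show ?thesis by auto
  qed
  show ?thesis
    unfolding Lbar_eq[OF z zs, of t "Suc M"]
  proof (rule cSUP_least[OF ne])
    fix \<gamma>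
    have "policy_total (weighted_dist zs z t (Suc M)) \<gamma> (t + Suc M) = (\<Sum>ys | length ys = Suc (t + M). \<Sum>y\<in>UNIV.
       weighted_dist zs z t (Suc M) (ys @ [y]) (actions \<gamma> ys (t + M) @ [\<gamma> ys (actions \<gamma> ys (t + M))]))"
      by (simp add: policy_total_Suc)
    also have "\<dots> \<le> (\<Sum>ys | length ys = Suc (t + M). ?C * weighted_dist zs z t M ys (actions \<gamma> ys (t + M)))"
      by (intro sum_mono weighted_dist_step[OF z zs]) auto
    also have "\<dots> = ?C * policy_total (weighted_dist zs z t M) \<gamma> (t + M)"
      by (simp add: policy_total_def sum_distrib_left)
    also have "\<dots> \<le> ?C * Lbar T Q \<rho> z zs t M"
      by (intro mult_left_mono policy_total_le_Lbar z zs C)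
    finally show "policy_total (weighted_dist zs z t (Suc M)) \<gamma> (t + Suc M) \<le> ?C * Lbar T Q \<rho> z zs t M" .
  qed
qed

end

theorem lemma2:
  fixes T :: "'x::metric_space \<times> 'u::{finite, discrete_topology} \<Rightarrow> 'x measure"
    and Q :: "'x \<Rightarrow> 'y::finite measure"
    and c :: "'x \<times> 'u \<Rightarrow> real"
    and \<rho> z0 zstar :: "'x measure"
    and \<alpha> K1 :: real
    and t N :: nat
  assumes "compact (UNIV :: 'x set)"
    and "T \<in> borel \<Otimes>\<^sub>M count_space UNIV \<rightarrow>\<^sub>M prob_algebra borel"
    and "Q \<in> borel \<rightarrow>\<^sub>M prob_algebra (count_space UNIV)"
    and "\<And>xs us x u. (\<lambda>n. (xs n, us n)) \<longlonglongrightarrow> (x, u) \<Longrightarrow>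
           (\<lambda>n. tv_dist (T (xs n, us n)) (T (x, u))) \<longlonglongrightarrow> 0"
    and "0 \<le> \<alpha>"
    and "\<And>x x' u. tv_dist (T (x, u)) (T (x', u)) \<le> \<alpha> * dist x x'"
    and "0 \<le> K1"
    and "\<And>x x' u. \<bar>c (x, u) - c (x', u)\<bar> \<le> K1 * dist x x'"
    and "continuous_on UNIV c"
    and "bounded (range c)"
    and "\<rho> \<in> space (prob_algebra borel)"
    and "z0 \<in> space (prob_algebra borel)"
    and "zstar \<in> space (prob_algebra borel)"
    and "1 \<le> N"
  shows "Lbar T Q \<rho> z0 zstar t N
           \<le> \<alpha> * (diameter (UNIV :: 'x set) / 2)
              * (2 - dobrushin borel (count_space UNIV) Q) * Lbar T Q \<rho> z0 zstar t (N - 1)"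
proof -
  have "pomdp T Q \<rho>" by (rule pomdp.intro[OF assms(2,3,11)])
  moreover have "compact_space TYPE('x)" by (rule compact_space.intro[OF assms(1)])
  moreover have "regular_pomdp_axioms T \<alpha>" by (rule regular_pomdp_axioms.intro[OF assms(5,6)])
  ultimately interpret regular_pomdp T Q \<rho> \<alpha> by (rule regular_pomdp.intro)
  obtain M where "N = Suc M" using assms(14) by (cases N) auto
  then show ?thesis using Lbar_step[OF assms(12,13), of t M] by simp
qed

end
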